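(* Let $\lambda/\mu$ be a skew shape and let $(\theta_1,\theta_2,\dots,\theta_n)$ be its Lascoux--Pragacz decomposition. Then $$\mathrm{OOT}(\lambda/\mu)=\det\left[\mathrm{OOT}(\theta_i\mathbin{\#}\theta_j)\right]_{i,j=1}^{n},$$ where $\theta_i\mathbin{\#}\theta_j$ is placed on the border strip of $\lambda$.
   Context: $\lambda$ is a partition with $d=\ell(\lambda)$ parts and $[\mu]\subseteq[\lambda]$. The content of a cell $(i,j)$ is $c(i,j)=j-i$. $\mathrm{OOT}(\lambda/\mu)$ is the number of semistandard Young tableaux $T$ of shape $\mu$ with entries in $\{1,\dots,d\}$ such that $c(u)<\lambda_{d+1-T(u)}$ for all $u\in[\mu]$ (the nonzero terms of the Okounkov--Olshanski formula $f^{\lambda/\mu}=\frac{|\lambda/\mu|!}{\prod_{u\in[\lambda]}h(u)}\sum_T\prod_{u\in[\mu]}(\lambda_{d+1-T(u)}-c(u))$, where the sum is over all semistandard $T$ of shape $\mu$ with entries at most $d$, $f^{\lambda/\mu}$ counts standard Young tableaux of shape $\lambda/\mu$, and $h(u)$ is the hook length of $u$ in $\lambda$). This number depends only on the skew diagram $[\lambda/\mu]$ as a set of cells in the plane, so $\mathrm{OOT}(S)$ is well defined for a set of cells $S$ that is the diagram of some skew shape. A strip is a connected skew shape containing no $2\times2$ square; its contents form an interval with each value occurring once. For a strip $\theta$, $\theta[a,b]$ is the substrip consisting of its cells with contents from $a$ to $b$. If $m,n'$ are the minimum and maximum contents of cells of $[\lambda/\mu]$ and $\theta$ is a strip with minimum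 and maximum contents $m,n'$, the outside decomposition of $\lambda/\mu$ with cutting strip $\theta$ is the collection of all connected components of the intersections of $[\lambda/\mu]$ with the diagonal (northwest--southeast) translates of $\theta$. The Lascoux--Pragacz decomposition is the outside decomposition whose cutting strip $\theta$ is the outer border strip of $\lambda$, i.e. the set of cells $(i,j)\in[\lambda]$ with $(i+1,j+1)\notin[\lambda]$ (restricted to contents from $m$ to $n'$). If the contents of $\theta_i$ range from $m_i$ to $n_i$, then $\theta_i\mathbin{\#}\theta_j=\theta[m_i,n_j]$, regarded as a subset of the border strip of $\lambda$ in its original position; this is the diagram of a skew shape $\lambda/\nu$ and $\mathrm{OOT}(\theta_i\mathbin{\#}\theta_j)=\mathrm{OOT}(\lambda/\nu)$. Conventions for degenerate entries: $\mathrm{OOT}(\theta_i\mathbin{\#}\theta_j)=1$ if $n_j=m_i-1$ (empty strip), and $\mathrm{OOT}(\theta_i\mathbin{\#}\theta_j)=0$ if $n_j<m_i-1$. *)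

theory Defs
  imports "Jordan_Normal_Form.Determinant" "HOL-Library.FuncSet"
begin

(* A partition is the list of its (positive) parts, so that its number of parts is the
   length of the list.  Cells are matrix coordinates (row, column) starting at 1; they are
   pairs of integers so that diagonal translates can be taken in both directions. *)

type_synonym cell = "int \<times> int"

definition is_partition :: "nat list \<Rightarrow> bool" where
  "is_partition lam \<longleftrightarrow> sorted_wrt (\<ge>) lam \<and> 0 \<notin> set lam"

definition part :: "nat list \<Rightarrow> nat \<Rightarrow> nat" where
  "part lam i = (if 1 \<le> i \<and> i \<le> length lam then lam ! (i - 1) else 0)"

definition diagram :: "nat list \<Rightarrow> cell set" where
  "diagram lam = {(i, j). 1 \<le> i \<and> 1 \<le> j \<and> j \<le> int (part lam (nat i))}"

definition skew_diagram :: "nat list \<Rightarrow> nat list \<Rightarrow> cell set" where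
  "skew_diagram lam mu = diagram lam - diagram mu"

definition content :: "cell \<Rightarrow> int" where
  "content u = snd u - fst u"

definition semistandard_on :: "cell set \<Rightarrow> (cell \<Rightarrow> nat) \<Rightarrow> bool" where
  "semistandard_on D T \<longleftrightarrow>
     (\<forall>i j. (i, j) \<in> D \<and> (i, j + 1) \<in> D \<longrightarrow> T (i, j) \<le> T (i, j + 1)) \<and>
     (\<forall>i j. (i, j) \<in> D \<and> (i + 1, j) \<in> D \<longrightarrow> T (i, j) < T (i + 1, j))"

(* Tableaux are extensional functions on the diagram of mu, so that the cardinality counts
   fillings.  OOT lam mu is meant for partitions with diagram mu contained in diagram lam. *)

definition OO_tableaux :: "nat list \<Rightarrow> nat list \<Rightarrow> (cell \<Rightarrow> nat) set" where
  "OO_tableaux lam mu =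
     {T \<in> diagram mu \<rightarrow>\<^sub>E {1..length lam}.
        semistandard_on (diagram mu) T \<and>
        (\<forall>u \<in> diagram mu. content u < int (part lam (length lam + 1 - T u)))}"

definition OOT :: "nat list \<Rightarrow> nat list \<Rightarrow> nat" where
  "OOT lam mu = card (OO_tableaux lam mu)"

definition adjacent :: "cell \<Rightarrow> cell \<Rightarrow> bool" where
  "adjacent u v \<longleftrightarrow> \<bar>fst u - fst v\<bar> + \<bar>snd u - snd v\<bar> = 1"

definition connected_components :: "cell set \<Rightarrow> cell set set" where
  "connected_components S =
     S // ({(u, v). u \<in> S \<and> v \<in> S \<and> adjacent u v}\<^sup>* \<inter> S \<times> S)"

definition translate :: "int \<Rightarrow> cell set \<Rightarrow> cell set" where
  "translate k S = (\<lambda>(i, j). (i + k, j + k)) ` S"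

definition substrip :: "cell set \<Rightarrow> int \<Rightarrow> int \<Rightarrow> cell set" where
  "substrip theta a b = {u \<in> theta. a \<le> content u \<and> content u \<le> b}"

definition min_content :: "cell set \<Rightarrow> int" where
  "min_content S = Min (content ` S)"

definition max_content :: "cell set \<Rightarrow> int" where
  "max_content S = Max (content ` S)"

definition outside_decomposition :: "nat list \<Rightarrow> nat list \<Rightarrow> cell set \<Rightarrow> cell set set" where
  "outside_decomposition lam mu theta =
     (\<Union>k. connected_components (skew_diagram lam mu \<inter> translate k theta))"

definition border_strip :: "nat list \<Rightarrow> cell set" where
  "border_strip lam = {(i, j) \<in> diagram lam. (i + 1, j + 1) \<notin> diagram lam}"

(* For mu = lam the contents below are those of an empty set and hence unspecified, but the
   resulting decomposition is empty whatever the cutting strip is. *)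

definition LP_cutting_strip :: "nat list \<Rightarrow> nat list \<Rightarrow> cell set" where
  "LP_cutting_strip lam mu =
     substrip (border_strip lam)
       (min_content (skew_diagram lam mu)) (max_content (skew_diagram lam mu))"

definition LP_decomposition :: "nat list \<Rightarrow> nat list \<Rightarrow> cell set set" where
  "LP_decomposition lam mu = outside_decomposition lam mu (LP_cutting_strip lam mu)"

definition strip_join :: "cell set \<Rightarrow> cell set \<Rightarrow> cell set \<Rightarrow> cell set" where
  "strip_join theta A B = substrip theta (min_content A) (max_content B)"

(* The partition nu for which the set S of cells is the skew diagram lam/nu. *)

definition inner_partition :: "nat list \<Rightarrow> cell set \<Rightarrow> nat list" where
  "inner_partition lam S =
     (THE nu. is_partition nu \<and> diagram nu \<subseteq> diagram lam \<and> skew_diagram lam nu = S)"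

definition OOT_join :: "nat list \<Rightarrow> cell set \<Rightarrow> cell set \<Rightarrow> cell set \<Rightarrow> nat" where
  "OOT_join lam theta A B =
     (if max_content B < min_content A - 1 then 0
      else if max_content B = min_content A - 1 then 1
      else OOT lam (inner_partition lam (strip_join theta A B)))"

end

theory Submission
  imports Defs
begin

text \<open>
  Let \<open>d\<close> be the number of parts of \<open>lam\<close>.  A partition \<open>mu\<close> inside \<open>lam\<close> is recorded by the set
  of the contents of the last cells of its rows \<open>1, ..., d\<close>, where an empty row \<open>j\<close> contributes
  \<open>-j\<close>.  For fixed \<open>lam\<close>, the number of tableaux is a minor of a single matrix, indexed by this
  set, and the theorem is Cramer's rule for these minors.

  The minors come from deleting the largest entry of a tableau.  Its cells form a horizontal strip.
  Since the bound on the content of a cell depends on its entry alone, it constrains the strips of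
  different entries separately, and the numbers of tableaux satisfy a recursion.  Row operations
  give the same recursion for determinants whose entries depend on one row end each
  (\<open>card_flagged_tableaux\<close>).

  The minor belonging to \<open>lam\<close> itself is 1, because the bounds leave exactly one tableau of shape
  \<open>lam\<close> (\<open>OOT_self\<close>), and a shape that does not fit into \<open>lam\<close> has none
  (\<open>flagged_tableau_fits\<close>).  Hence the vectors of \<open>lam\<close> form a basis, and the minor of
  \<open>mu\<close> is the determinant of the coordinates of the vectors of \<open>mu\<close>.  Row ends common to \<open>lam\<close> and
  \<open>mu\<close> give unit vectors and drop out.  The other coordinates are, up to sign, minors in which one
  row end \<open>b\<close> of \<open>lam\<close> is exchanged for a row end \<open>a - 1\<close> of \<open>mu\<close>.  If \<open>a \<le> b\<close>, such an exchange
  removes the cells with contents \<open>a, ..., b\<close> from the border strip of \<open>lam\<close>; otherwise it adds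
  cells and the minor vanishes (\<open>OOT_join_arcs\<close>).

  It remains to see that the strips pair the exchanged row ends in such a way that all signs
  cancel.  The translates of the border strip meet \<open>lam/mu\<close> in the superlevel sets of the function
  that counts the cells of \<open>lam/mu\<close> on each diagonal, so the strips are the maximal intervals of
  these sets (\<open>LP_decomposition_arcs\<close>).  Such intervals are nested or disjoint, and
  this makes the signs cancel (\<open>noncrossing_exchange\<close>).
\<close>

section \<open>Tableaux with bounded contents and horizontal strips\<close>

text \<open>
  A shape with at most \<open>t\<close> rows is coded by the contents of the last cells of its rows: the
  last cell of row \<open>Suc j\<close> has content \<open>x j\<close>, and \<open>x j = - int j - 1\<close> for an empty row.  For a
  partition this sequence is strictly decreasing, which is what makes it a set of indices of a
  minor later on.
\<close>

definition row_shape :: "nat \<Rightarrow> (nat \<Rightarrow> int) \<Rightarrow> cell set" where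
  "row_shape t x = {(i, j). 1 \<le> i \<and> i \<le> int t \<and> 1 \<le> j \<and> j - i \<le> x (nat (i - 1))}"

text \<open>
  The bound on the contents depends on the entry alone.  Therefore the cells of a tableau that
  carry the entry \<open>t\<close> are constrained independently of the smaller entries, and the tableaux can
  be counted by peeling off the largest entry.
\<close>

definition flagged_tableaux :: "(nat \<Rightarrow> int) \<Rightarrow> nat \<Rightarrow> cell set \<Rightarrow> (cell \<Rightarrow> nat) set" where
  "flagged_tableaux L t D =
     {T \<in> D \<rightarrow>\<^sub>E {1..t}. semistandard_on D T \<and> (\<forall>u \<in> D. content u < L (T u))}"

lemma finite_row_shape: "finite (row_shape t x)"
proof (rule finite_subset)
  show "row_shape t x \<subseteq> (SIGMA i:{1..int t}. {1..x (nat (i - 1)) + i})"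
    by (auto simp: row_shape_def)
qed auto

lemma finite_flagged_tableaux: "finite D \<Longrightarrow> finite (flagged_tableaux L t D)"
  unfolding flagged_tableaux_def
  by (rule finite_subset[of _ "D \<rightarrow>\<^sub>E {1..t}"]) (auto intro: finite_PiE)

lemma semistandard_row_mono:
  assumes "semistandard_on D T" and "a \<le> b" and "\<And>j. a \<le> j \<Longrightarrow> j \<le> b \<Longrightarrow> (i, j) \<in> D"
  shows "T (i, a) \<le> T (i, b)"
  using assms(2,3)
proof (induction b rule: int_ge_induct)
  case (step k)
  have "T (i, a) \<le> T (i, k)" using step by auto
  also have "\<dots> \<le> T (i, k + 1)"
    using assms(1) step.prems[of k] step.prems[of "k + 1"] step.hyps by (auto simp: semistandard_on_def)
  finally show ?case .
qed simp

lemma semistandard_column_growth: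
  assumes "semistandard_on D T" and "a \<le> b" and "\<And>i. a \<le> i \<Longrightarrow> i \<le> b \<Longrightarrow> (i, j) \<in> D"
  shows "int (T (a, j)) + (b - a) \<le> int (T (b, j))"
  using assms(2,3)
proof (induction b rule: int_ge_induct)
  case (step k)
  have "int (T (a, j)) + (k - a) \<le> int (T (k, j))" using step by auto
  moreover have "T (k, j) < T (k + 1, j)"
    using assms(1) step.prems[of k] step.prems[of "k + 1"] step.hyps by (auto simp: semistandard_on_def)
  ultimately show ?case by simp
qed simp

lemma initial_segment_int:
  fixes S :: "int set"
  assumes "finite S" and "\<And>c. c \<in> S \<Longrightarrow> 1 \<le> c" and "\<And>c c'. c \<in> S \<Longrightarrow> 1 \<le> c' \<Longrightarrow> c' \<le> c \<Longrightarrow> c' \<in> S"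
  shows "\<exists>k\<ge>0. S = {1..k}"
proof (cases "S = {}")
  case True
  then show ?thesis by (intro exI[of _ 0]) auto
next
  case False
  have "S \<subseteq> {1..Max S}" using assms(2) Max_ge[OF assms(1)] by auto
  moreover have "{1..Max S} \<subseteq> S" using assms(3)[OF Max_in[OF assms(1) False]] by auto
  ultimately have "S = {1..Max S}" by blast
  moreover have "Max S \<ge> 0" using assms(2)[OF Max_in[OF assms(1) False]] by simp
  ultimately show ?thesis by blast
qed

lemma strict_decreasing_le:
  fixes x :: "nat \<Rightarrow> int"
  assumes "\<And>j. Suc j < t \<Longrightarrow> x (Suc j) < x j" and "i \<le> j" and "j < t"
  shows "x j + int (j - i) \<le> x i"
  using assms(2,3)
proof (induction j rule: dec_induct)
  case (step n)
  then show ?case using assms(1)[of n] by simp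
qed simp

lemma row_shape_column_closed:
  assumes "\<And>j. Suc j < t \<Longrightarrow> x (Suc j) < x j" and "(i, j) \<in> row_shape t x" and "1 \<le> i'" "i' \<le> i"
  shows "(i', j) \<in> row_shape t x"
proof -
  have "x (nat (i - 1)) + int (nat (i - 1) - nat (i' - 1)) \<le> x (nat (i' - 1))"
    using assms(2-4) by (intro strict_decreasing_le[of t x, OF assms(1)]) (auto simp: row_shape_def)
  then show ?thesis using assms(2-4) by (auto simp: row_shape_def)
qed

text \<open>
  The shapes that can be left over when the cells with entry \<open>Suc t\<close> are removed: these cells form
  a horizontal strip, so each new row end interlaces with the old ones, and a row that reaches
  the bound for \<open>Suc t\<close> cannot lose a cell at all.
\<close>

definition strip_removals :: "(nat \<Rightarrow> int) \<Rightarrow> nat \<Rightarrow> (nat \<Rightarrow> int) \<Rightarrow> (nat \<Rightarrow> int) set" where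
  "strip_removals L t x =
     PiE {..<t} (\<lambda>j. if x j < L (Suc t) then {x (Suc j)<..x j} else {x j})"

text \<open>
  In the bottom row, strictness down the columns forces the entry \<open>Suc t\<close>, so a bottom row that
  reaches the bound for \<open>Suc t\<close> cannot be filled.
\<close>

lemma flagged_tableaux_empty:
  assumes dec: "\<And>j. Suc j < Suc t \<Longrightarrow> x (Suc j) < x j"
    and L: "L (Suc t) \<ge> 0" and ge: "x t \<ge> L (Suc t)"
  shows "flagged_tableaux L (Suc t) (row_shape (Suc t) x) = {}"
proof (rule ccontr)
  assume "\<not> ?thesis"
  then obtain T where T: "T \<in> flagged_tableaux L (Suc t) (row_shape (Suc t) x)" by blast
  let ?D = "row_shape (Suc t) x"
  let ?c = "x t + int t + 1"
  have u: "(int t + 1, ?c) \<in> ?D" using L ge by (auto simp: row_shape_def)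
  have "int (T (1, ?c)) + (int t + 1 - 1) \<le> int (T (int t + 1, ?c))"
  proof (rule semistandard_column_growth)
    show "semistandard_on ?D T" using T by (simp add: flagged_tableaux_def)
    fix i :: int assume "1 \<le> i" "i \<le> int t + 1"
    then show "(i, ?c) \<in> ?D" using row_shape_column_closed[OF dec u] by auto
  qed auto
  moreover have "T (1, ?c) \<in> {1..Suc t}" "T (int t + 1, ?c) \<in> {1..Suc t}"
    using T u row_shape_column_closed[OF dec u, of 1] by (auto simp: flagged_tableaux_def)
  ultimately have "T (int t + 1, ?c) = Suc t" by auto
  moreover have "content (int t + 1, ?c) < L (T (int t + 1, ?c))"
    using T u by (auto simp: flagged_tableaux_def)
  ultimately show False using ge by (simp add: content_def)
qed

definition add_top_entries :: "nat \<Rightarrow> cell set \<Rightarrow> cell set \<Rightarrow> (cell \<Rightarrow> nat) \<Rightarrow> cell \<Rightarrow> nat" where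
  "add_top_entries t D E T u = (if u \<in> E then T u else if u \<in> D then t else undefined)"

lemma strip_removals_bounds:
  assumes "\<And>j. Suc j < Suc t \<Longrightarrow> x (Suc j) < x j" and "y \<in> strip_removals L t x" and "j < t"
  shows "x (Suc j) < y j" "y j \<le> x j" "y j < x j \<Longrightarrow> x j < L (Suc t)"
proof -
  have "y j \<in> (if x j < L (Suc t) then {x (Suc j)<..x j} else {x j})"
    using assms(2,3) unfolding strip_removals_def by blast
  with assms(1)[of j] assms(3)
  show "x (Suc j) < y j" "y j \<le> x j" "y j < x j \<Longrightarrow> x j < L (Suc t)"
    by (auto split: if_splits)
qed

text \<open>
  Deleting the entries \<open>Suc t\<close> can be undone: the remaining shape says where they were.  Strictness
  down the columns keeps the bottom row out of the remaining shape and makes the row ends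
  interlace; the bound on contents matters only for the row ends that move.
\<close>

lemma flagged_tableaux_Suc:
  assumes dec: "\<And>j. Suc j < Suc t \<Longrightarrow> x (Suc j) < x j"
    and low: "x t \<ge> - int t - 1" and lt: "x t < L (Suc t)"
  shows "bij_betw (\<lambda>(y, T). add_top_entries (Suc t) (row_shape (Suc t) x) (row_shape t y) T)
           (SIGMA y : strip_removals L t x. flagged_tableaux L t (row_shape t y))
           (flagged_tableaux L (Suc t) (row_shape (Suc t) x))"
proof -
  let ?D = "row_shape (Suc t) x"
  let ?f = "\<lambda>(y, T). add_top_entries (Suc t) ?D (row_shape t y) T"
  let ?A = "SIGMA y : strip_removals L t x. flagged_tableaux L t (row_shape t y)"
  let ?B = "flagged_tableaux L (Suc t) ?D"
  note bounds = strip_removals_bounds[of t x _ L, OF dec]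
  have xlow: "x j \<ge> - int j - 1" if "j \<le> t" for j
    using strict_decreasing_le[of "Suc t" x j t] dec low that by auto
  have sub: "row_shape t y \<subseteq> ?D" if "y \<in> strip_removals L t x" for y
  proof
    fix u assume u: "u \<in> row_shape t y"
    obtain i j where [simp]: "u = (i, j)" by fastforce
    have "y (nat (i - 1)) \<le> x (nat (i - 1))"
      using u by (intro bounds(2)[OF _ that]) (auto simp: row_shape_def)
    then show "u \<in> ?D" using u by (auto simp: row_shape_def)
  qed
  have into: "?f (y, T) \<in> ?B" if y: "y \<in> strip_removals L t x"
    and T: "T \<in> flagged_tableaux L t (row_shape t y)" for y T
  proof -
    let ?E = "row_shape t y"
    let ?T = "add_top_entries (Suc t) ?D ?E T"
    have TE: "T u \<in> {1..t}" if "u \<in> ?E" for u using T that by (auto simp: flagged_tableaux_def)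
    have ss: "semistandard_on ?E T" using T by (simp add: flagged_tableaux_def)
    have le: "?T u \<le> Suc t" if "u \<in> ?D" for u using TE[of u] that by (auto simp: add_top_entries_def)
    have "?T \<in> ?D \<rightarrow>\<^sub>E {1..Suc t}"
      using TE sub[OF y] by (fastforce simp: add_top_entries_def)
    moreover have "semistandard_on ?D ?T"
      unfolding semistandard_on_def
    proof (intro conjI allI impI; elim conjE)
      fix i j assume ij: "(i, j) \<in> ?D" and ij': "(i, j + 1) \<in> ?D"
      show "?T (i, j) \<le> ?T (i, j + 1)"
      proof (cases "(i, j + 1) \<in> ?E")
        case True
        then have "(i, j) \<in> ?E" using ij by (auto simp: row_shape_def)
        then show ?thesis using True ss by (auto simp: add_top_entries_def semistandard_on_def)
      next
        case False
        then show ?thesis using le[OF ij] ij' by (simp add: add_top_entries_def)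
      qed
    next
      fix i j assume ij: "(i, j) \<in> ?D" and ij': "(i + 1, j) \<in> ?D"
      have "nat i = Suc (nat (i - 1))" using ij by (auto simp: row_shape_def)
      then have "x (nat i) < y (nat (i - 1))"
        using bounds(1)[OF _ y, of "nat (i - 1)"] ij' ij by (auto simp: row_shape_def)
      then have E: "(i, j) \<in> ?E" using ij ij' by (auto simp: row_shape_def)
      show "?T (i, j) < ?T (i + 1, j)"
      proof (cases "(i + 1, j) \<in> ?E")
        case True
        then show ?thesis using ss E by (auto simp: add_top_entries_def semistandard_on_def)
      next
        case False
        then show ?thesis using TE[OF E] E ij' by (simp add: add_top_entries_def)
      qed
    qed
    moreover have "content u < L (?T u)" if u: "u \<in> ?D" for u
    proof (cases "u \<in> ?E")
      case True
      then show ?thesis using T by (auto simp: add_top_entries_def flagged_tableaux_def)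
    next
      case False
      obtain i j where [simp]: "u = (i, j)" by fastforce
      have c: "j - i \<le> x (nat (i - 1))" using u by (auto simp: row_shape_def)
      show ?thesis
      proof (cases "i \<le> int t")
        case True
        then have "y (nat (i - 1)) < x (nat (i - 1))" using False u by (auto simp: row_shape_def)
        then have "x (nat (i - 1)) < L (Suc t)"
          using True u by (intro bounds(3)[OF _ y]) (auto simp: row_shape_def)
        then show ?thesis using c False u by (auto simp: add_top_entries_def content_def)
      next
        case F: False
        then have "nat (i - 1) = t" using u by (auto simp: row_shape_def)
        then show ?thesis using c lt False u by (auto simp: add_top_entries_def content_def)
      qed
    qed
    ultimately show ?thesis by (simp add: flagged_tableaux_def)
  qed
  have small: "row_shape t y = {u \<in> ?D. ?f (y, T) u \<le> t}" if y: "y \<in> strip_removals L t x"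
    and T: "T \<in> flagged_tableaux L t (row_shape t y)" for y T
    using T sub[OF y] by (auto simp: add_top_entries_def flagged_tableaux_def split: if_splits)
  have "inj_on ?f ?A"
  proof (rule inj_onI)
    fix p q assume p: "p \<in> ?A" and q: "q \<in> ?A" and eq: "?f p = ?f q"
    obtain y T y' T' where [simp]: "p = (y, T)" "q = (y', T')" by fastforce
    have y: "y \<in> strip_removals L t x" "y' \<in> strip_removals L t x" using p q by auto
    have E: "row_shape t y = row_shape t y'"
      using small[of y T] small[of y' T'] p q eq by auto
    \<comment> \<open>Equal shapes have equal row ends only because \<open>z j\<close> is at least its value for an empty row.\<close>
    have noless: "\<not> z j < z' j" if "j < t" "z \<in> strip_removals L t x"
      "row_shape t z = row_shape t z'" for z z' j
    proof
      assume "z j < z' j"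
      moreover have "z j > - int j - 2" using bounds(1)[OF _ that(2,1)] xlow[of "Suc j"] that(1) by auto
      ultimately have "(int j + 1, z' j + int j + 1) \<in> row_shape t z'"
        "(int j + 1, z' j + int j + 1) \<notin> row_shape t z"
        using \<open>j < t\<close> by (auto simp: row_shape_def)
      then show False using that(3) by simp
    qed
    have "y = y'"
    proof (rule PiE_ext[of y "{..<t}" _ y'])
      show "y j = y' j" if "j \<in> {..<t}" for j
        using noless[of j y y'] noless[of j y' y] that E y by auto
    qed (use y in \<open>auto simp: strip_removals_def\<close>)
    moreover have "T u = T' u" for u
    proof (cases "u \<in> row_shape t y")
      case True
      then show ?thesis using fun_cong[OF eq, of u] \<open>y = y'\<close> by (simp add: add_top_entries_def)
    next
      case False
      have "T \<in> row_shape t y \<rightarrow>\<^sub>E {1..t}" "T' \<in> row_shape t y \<rightarrow>\<^sub>E {1..t}"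
        using p q \<open>y = y'\<close> by (auto simp: flagged_tableaux_def)
      then show ?thesis using PiE_arb[OF _ False] by metis
    qed
    ultimately show "p = q" by auto
  qed
  moreover have "?B \<subseteq> ?f ` ?A"
  proof
    fix T assume T: "T \<in> ?B"
    have ss: "semistandard_on ?D T" and TD: "\<And>u. u \<in> ?D \<Longrightarrow> T u \<in> {1..Suc t}"
      and TL: "\<And>u. u \<in> ?D \<Longrightarrow> content u < L (T u)"
      using T by (auto simp: flagged_tableaux_def)
    have row_mono: "T (i, a) \<le> T (i, b)" if "(i, b) \<in> ?D" "1 \<le> a" "a \<le> b" for i a b
      using that by (intro semistandard_row_mono[OF ss]) (auto simp: row_shape_def)
    have "\<exists>k\<ge>0. {c. (int j + 1, c) \<in> ?D \<and> T (int j + 1, c) \<le> t} = {1..k}" for j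
    proof (rule initial_segment_int)
      show "finite {c. (int j + 1, c) \<in> ?D \<and> T (int j + 1, c) \<le> t}"
        by (rule finite_subset[of _ "{1..x j + int j + 1}"]) (auto simp: row_shape_def)
    next
      fix c c' assume c: "c \<in> {c. (int j + 1, c) \<in> ?D \<and> T (int j + 1, c) \<le> t}" "1 \<le> c'" "c' \<le> c"
      then show "c' \<in> {c. (int j + 1, c) \<in> ?D \<and> T (int j + 1, c) \<le> t}"
        using row_mono[of "int j + 1" c c'] by (auto simp: row_shape_def)
    qed (auto simp: row_shape_def)
    then obtain k where k: "\<And>j. k j \<ge> 0"
      "\<And>j. {c. (int j + 1, c) \<in> ?D \<and> T (int j + 1, c) \<le> t} = {1..k j}" by metis
    \<comment> \<open>\<open>k j\<close> is the number of entries of row \<open>Suc j\<close> that are at most \<open>t\<close>.\<close>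
    define y where "y = (\<lambda>j\<in>{..<t}. k j - int j - 1)"
    have kiff: "(int j + 1, c) \<in> ?D \<and> T (int j + 1, c) \<le> t \<longleftrightarrow> 1 \<le> c \<and> c \<le> k j" for j c
    proof -
      have "c \<in> {c. (int j + 1, c) \<in> ?D \<and> T (int j + 1, c) \<le> t} \<longleftrightarrow> c \<in> {1..k j}"
        by (simp only: k(2))
      then show ?thesis by (simp only: mem_Collect_eq atLeastAtMost_iff)
    qed
    have top: "T (int t + 1, c) = Suc t" if u: "(int t + 1, c) \<in> ?D" for c
    proof -
      have "int (T (1, c)) + (int t + 1 - 1) \<le> int (T (int t + 1, c))"
        using row_shape_column_closed[OF dec u] by (intro semistandard_column_growth[OF ss]) auto
      moreover have "T (1, c) \<in> {1..Suc t}" "T (int t + 1, c) \<in> {1..Suc t}"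
        using TD u row_shape_column_closed[OF dec u, of 1] by auto
      ultimately show ?thesis by auto
    qed
    have small_iff: "u \<in> row_shape t y \<longleftrightarrow> u \<in> ?D \<and> T u \<le> t" for u
    proof -
      obtain i c where [simp]: "u = (i, c)" by fastforce
      show ?thesis
      proof (cases "1 \<le> i \<and> i \<le> int t")
        case True
        then obtain j where j: "i = int j + 1" "j < t"
          using that[of "nat (i - 1)"] by auto
        have "u \<in> ?D \<and> T u \<le> t \<longleftrightarrow> 1 \<le> c \<and> c \<le> k j" unfolding j(1) \<open>u = (i, c)\<close> by (rule kiff)
        moreover have "u \<in> row_shape t y \<longleftrightarrow> 1 \<le> c \<and> c \<le> k j"
          using j(2) by (simp add: row_shape_def y_def j(1) algebra_simps)
        ultimately show ?thesis by blast
      next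
        case False
        show ?thesis
        proof
          assume "u \<in> row_shape t y" then show "u \<in> ?D \<and> T u \<le> t" using False by (auto simp: row_shape_def)
        next
          assume a: "u \<in> ?D \<and> T u \<le> t"
          then have "i = int t + 1" using False by (auto simp: row_shape_def)
          with a top[of c] show "u \<in> row_shape t y" by auto
        qed
      qed
    qed
    have yin: "y \<in> strip_removals L t x"
      unfolding strip_removals_def
    proof (rule PiE_I)
      fix j assume "j \<in> {..<t}"
      then have j: "j < t" by simp
      have yj: "y j = k j - int j - 1" using j by (simp add: y_def)
      have upper: "y j \<le> x j"
      proof (cases "k j = 0")
        case True
        then show ?thesis using yj xlow[of j] j by auto
      next
        case False
        then have "(int j + 1, k j) \<in> ?D" using kiff[of j "k j"] k(1)[of j] by auto
        then show ?thesis using yj by (auto simp: row_shape_def)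
      qed
      have lower: "x (Suc j) < y j"
      proof (rule ccontr)
        assume "\<not> ?thesis"
        then have ge: "x (Suc j) \<ge> k j - int j - 1" using yj by simp
        have D2: "(int j + 1 + 1, k j + 1) \<in> ?D" using ge j k(1)[of j]
          by (auto simp: row_shape_def nat_add_distrib)
        have D1: "(int j + 1, k j + 1) \<in> ?D" using row_shape_column_closed[OF dec D2, of "int j + 1"] by auto
        have "T (int j + 1, k j + 1) < T (int j + 1 + 1, k j + 1)"
          using ss D1 D2 unfolding semistandard_on_def by blast
        also have "\<dots> \<le> Suc t" using TD[OF D2] by simp
        finally show False using kiff[of j "k j + 1"] D1 k(1)[of j] by auto
      qed
      have "y j = x j" if "\<not> x j < L (Suc t)"
      proof (rule ccontr)
        assume "y j \<noteq> x j"
        then have "k j < x j + int j + 1" using upper yj by auto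
        moreover have D1: "(int j + 1, x j + int j + 1) \<in> ?D"
          using calculation k(1)[of j] j by (auto simp: row_shape_def)
        ultimately have "T (int j + 1, x j + int j + 1) = Suc t"
          using kiff[of j "x j + int j + 1"] TD[OF D1] by auto
        then show False using TL[OF D1] that by (simp add: content_def)
      qed
      with upper lower show "y j \<in> (if x j < L (Suc t) then {x (Suc j)<..x j} else {x j})" by auto
    qed (auto simp: y_def)
    let ?T = "restrict T (row_shape t y)"
    have "?T \<in> flagged_tableaux L t (row_shape t y)"
      using ss TL small_iff TD unfolding flagged_tableaux_def semistandard_on_def
      by (auto simp: restrict_PiE_iff)
    moreover have "?f (y, ?T) = T"
    proof
      fix u
      have "T u = Suc t" if "u \<in> ?D" "u \<notin> row_shape t y" using that small_iff[of u] TD[of u] by auto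
      moreover have "T u = undefined" if "u \<notin> ?D"
        using T PiE_arb[OF _ that] unfolding flagged_tableaux_def by blast
      ultimately show "?f (y, ?T) u = T u" by (auto simp: add_top_entries_def)
    qed
    ultimately show "T \<in> ?f ` ?A" using yin by (intro image_eqI[of _ _ "(y, ?T)"]) auto
  qed
  ultimately show ?thesis using into by (auto simp: bij_betw_def)
qed

section \<open>Counting tableaux by determinants\<close>

definition alternant :: "nat \<Rightarrow> (nat \<Rightarrow> int \<Rightarrow> int) \<Rightarrow> (nat \<Rightarrow> int) \<Rightarrow> int" where
  "alternant d p z = det (mat d d (\<lambda>(j, i). p i (z j)))"

text \<open>
  For \<open>i < t\<close> these numbers count the weakly increasing fillings, with entries from \<open>Suc i\<close> to \<open>t\<close>
  and subject to the content bounds, of a single row with contents from \<open>- int i\<close> to \<open>x\<close>; a step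
  sums over the possible ends after deletion of the entry \<open>Suc t\<close>.  They are path counts in the
  sense of Gessel and Viennot.
\<close>

fun flag_paths :: "(nat \<Rightarrow> int) \<Rightarrow> nat \<Rightarrow> nat \<Rightarrow> int \<Rightarrow> int" where
  "flag_paths L 0 i x = 0"
| "flag_paths L (Suc t) i x =
     (if i = t then (if x < L (Suc t) then 1 else 0)
      else if x < L (Suc t) then (\<Sum>y \<in> {- int t..x}. flag_paths L t i y)
      else flag_paths L t i x)"

text \<open>
  Multilinearity in all rows at once.
\<close>

lemma det_rows_sum_PiE:
  fixes f :: "nat \<Rightarrow> 'b \<Rightarrow> 'a :: comm_ring_1"
  assumes fin: "\<And>j. j < t \<Longrightarrow> finite (S j)"
  shows "det (mat t t (\<lambda>(j, i). \<Sum>y\<in>S j. f i y)) =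
    (\<Sum>y \<in> PiE {..<t} S. det (mat t t (\<lambda>(j, i). f i (y j))))"
proof -
  have eq: "(\<Prod>i = 0..<t. mat t t (\<lambda>(j, i). \<Sum>y\<in>S j. f i y) $$ (i, p i)) =
      (\<Sum>y \<in> PiE {..<t} S. \<Prod>i = 0..<t. mat t t (\<lambda>(j, i). f i (y j)) $$ (i, p i))"
    if p: "p permutes {0..<t}" for p
  proof -
    have pl: "p i < t" if "i < t" for i using permutes_in_image[OF p, of i] that by auto
    have "(\<Prod>i = 0..<t. mat t t (\<lambda>(j, i). \<Sum>y\<in>S j. f i y) $$ (i, p i)) =
        (\<Prod>i \<in> {..<t}. \<Sum>y\<in>S i. f (p i) y)"
      by (rule prod.cong) (auto simp: pl)
    also have "\<dots> = (\<Sum>y \<in> PiE {..<t} S. \<Prod>i \<in> {..<t}. f (p i) (y i))"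
      by (rule prod_sum_PiE) (auto simp: fin)
    also have "\<dots> = (\<Sum>y \<in> PiE {..<t} S. \<Prod>i = 0..<t. mat t t (\<lambda>(j, i). f i (y j)) $$ (i, p i))"
      by (rule sum.cong[OF refl], rule prod.cong) (simp_all add: pl lessThan_atLeast0)
    finally show ?thesis .
  qed
  have "det (mat t t (\<lambda>(j, i). \<Sum>y\<in>S j. f i y)) =
      (\<Sum>p\<in>{p. p permutes {0..<t}}. signof p *
         (\<Prod>i = 0..<t. mat t t (\<lambda>(j, i). \<Sum>y\<in>S j. f i y) $$ (i, p i)))"
    by (rule det_def') simp
  also have "\<dots> = (\<Sum>p\<in>{p. p permutes {0..<t}}. \<Sum>y \<in> PiE {..<t} S.
         signof p * (\<Prod>i = 0..<t. mat t t (\<lambda>(j, i). f i (y j)) $$ (i, p i)))"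
    by (intro sum.cong refl) (simp only: eq mem_Collect_eq sum_distrib_left)
  also have "\<dots> = (\<Sum>y \<in> PiE {..<t} S. \<Sum>p\<in>{p. p permutes {0..<t}}.
         signof p * (\<Prod>i = 0..<t. mat t t (\<lambda>(j, i). f i (y j)) $$ (i, p i)))"
    by (rule sum.swap)
  also have "\<dots> = (\<Sum>y \<in> PiE {..<t} S. det (mat t t (\<lambda>(j, i). f i (y j))))"
    by (intro sum.cong refl det_def'[symmetric]) simp
  finally show ?thesis .
qed

lemma alternant_flag_paths_eq_0:
  assumes "\<And>j. j \<le> t \<Longrightarrow> x j \<ge> L (Suc t)"
  shows "alternant (Suc t) (flag_paths L (Suc t)) x = 0"
proof -
  let ?M = "mat (Suc t) (Suc t) (\<lambda>(j, i). flag_paths L (Suc t) i (x j))"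
  have "det ?M = (\<Sum>i<Suc t. ?M $$ (i, t) * cofactor ?M i t)"
    by (rule laplace_expansion_column) auto
  also have "\<dots> = 0"
  proof (rule sum.neutral, rule ballI)
    fix j assume "j \<in> {..<Suc t}"
    then show "?M $$ (j, t) * cofactor ?M j t = 0" using assms[of j] by simp
  qed
  finally show ?thesis by (simp add: alternant_def)
qed

text \<open>
  The determinant obeys the recursion for tableaux.  Subtracting from each row its successor turns
  the partial sums in \<open>flag_paths\<close> into sums over the gap between two consecutive row ends, which
  is precisely the range of the interlacing row end, and it clears the last column except for a 1
  in the corner.  A row that reaches the bound is left alone: there \<open>flag_paths\<close> is already a
  single value and the last column is already 0.
\<close>

lemma alternant_flag_paths_Suc:
  assumes dec: "\<And>j. j < t \<Longrightarrow> x (Suc j) < x j" and low: "\<And>j. j \<le> t \<Longrightarrow> x j \<ge> - int t - 1"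
    and lt: "x t < L (Suc t)"
  shows "alternant (Suc t) (flag_paths L (Suc t)) x =
    (\<Sum>y \<in> strip_removals L t x. alternant t (flag_paths L t) y)"
proof -
  let ?M = "mat (Suc t) (Suc t) (\<lambda>(j, i). flag_paths L (Suc t) i (x j))"
  define U :: "int mat" where "U = mat (Suc t) (Suc t)
     (\<lambda>(j, k). (if k = j then 1 else 0) + (if k = Suc j then (if x j < L (Suc t) then -1 else 0) else 0))"
  define S where "S = (\<lambda>j. if x j < L (Suc t) then {x (Suc j)<..x j} else {x j})"
  let ?B = "mat t t (\<lambda>(j, i). \<Sum>y\<in>S j. flag_paths L t i y)"
  let ?R = "mat 1 t (\<lambda>(j, i). flag_paths L (Suc t) i (x t))"
  have M: "?M \<in> carrier_mat (Suc t) (Suc t)" and U: "U \<in> carrier_mat (Suc t) (Suc t)"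
    by (auto simp: U_def)
  have detU: "det U = 1"
  proof -
    have "det U = prod_list (diag_mat U)"
      by (rule det_upper_triangular[OF _ U]) (auto simp: U_def)
    also have "diag_mat U = map (\<lambda>i. 1) [0..<Suc t]"
      unfolding diag_mat_def by (intro map_cong) (auto simp: U_def)
    also have "prod_list (map (\<lambda>i. 1) [0..<Suc t]) = (1 :: int)"
      by (induction t) auto
    finally show ?thesis .
  qed
  \<comment> \<open>\<open>U\<close> performs the row subtractions; rows that reach the bound stay as they are.\<close>
  have entry: "(U * ?M) $$ (j, i) = flag_paths L (Suc t) i (x j) -
      (if j < t \<and> x j < L (Suc t) then flag_paths L (Suc t) i (x (Suc j)) else 0)"
    if "j \<le> t" "i \<le> t" for j i
  proof -
    have "(U * ?M) $$ (j, i) = (\<Sum>k\<in>{0..<Suc t}. U $$ (j, k) * ?M $$ (k, i))"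
      using that U M by (subst index_mult_mat) (auto simp: scalar_prod_def)
    also have "\<dots> = (\<Sum>k\<in>{0..<Suc t}. (if k = j then flag_paths L (Suc t) i (x k) else 0) +
       (if k = Suc j then (if x j < L (Suc t) then - flag_paths L (Suc t) i (x k) else 0) else 0))"
      using that by (intro sum.cong) (auto simp: U_def simp del: flag_paths.simps)
    also have "\<dots> = flag_paths L (Suc t) i (x j) -
      (if j < t \<and> x j < L (Suc t) then flag_paths L (Suc t) i (x (Suc j)) else 0)"
      using that by (cases "j = t") (simp_all add: sum.distrib sum.delta del: flag_paths.simps)
    finally show ?thesis .
  qed
  have lower: "x (Suc j) < L (Suc t)" if "x j < L (Suc t)" "j < t" for j
    using dec[OF that(2)] that(1) by simp
  have diff: "(\<Sum>y\<in>{- int t..x j}. f y) - (\<Sum>y\<in>{- int t..x (Suc j)}. f y) = (\<Sum>y\<in>{x (Suc j)<..x j}. f y)"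
    if "j < t" for j and f :: "int \<Rightarrow> int"
  proof -
    have "{- int t..x j} = {- int t..x (Suc j)} \<union> {x (Suc j)<..x j}"
      using dec[OF that] low[of "Suc j"] that by auto
    moreover have "sum f ({- int t..x (Suc j)} \<union> {x (Suc j)<..x j}) =
        sum f {- int t..x (Suc j)} + sum f {x (Suc j)<..x j}"
      by (rule sum.union_disjoint) auto
    ultimately show ?thesis by simp
  qed
  have "U * ?M = four_block_mat ?B (0\<^sub>m t 1) ?R (1\<^sub>m 1)"
  proof (rule eq_matI)
    fix j i assume "j < dim_row (four_block_mat ?B (0\<^sub>m t 1) ?R (1\<^sub>m 1))"
      "i < dim_col (four_block_mat ?B (0\<^sub>m t 1) ?R (1\<^sub>m 1))"
    then have "j \<le> t" "i \<le> t" by auto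
    then show "(U * ?M) $$ (j, i) = four_block_mat ?B (0\<^sub>m t 1) ?R (1\<^sub>m 1) $$ (j, i)"
      using lt lower[of j] diff[of j "flag_paths L t i"]
      unfolding entry[OF \<open>j \<le> t\<close> \<open>i \<le> t\<close>] by (auto simp: S_def)
  qed (auto simp: U_def)
  then have "det (U * ?M) = det ?B * det (1\<^sub>m 1)"
    by (simp only:) (rule det_four_block_mat_upper_right_zero, auto)
  then have "det ?M = det ?B" using det_mult[OF U M] detU by simp
  also have "\<dots> = (\<Sum>y \<in> PiE {..<t} S. det (mat t t (\<lambda>(j, i). flag_paths L t i (y j))))"
    by (rule det_rows_sum_PiE) (auto simp: S_def)
  finally show ?thesis by (simp add: alternant_def strip_removals_def S_def)
qed

text \<open>
  Both sides satisfy the same recursion in \<open>t\<close>.  What matters afterwards is that the functions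
  \<open>flag_paths L t i\<close> do not depend on the shape: for fixed bounds, the counts for all shapes are
  minors of one matrix.
\<close>

theorem card_flagged_tableaux:
  assumes "\<And>s. L s \<ge> 0" and "\<And>j. Suc j < t \<Longrightarrow> x (Suc j) < x j" and "\<And>j. j < t \<Longrightarrow> x j \<ge> - int t"
  shows "int (card (flagged_tableaux L t (row_shape t x))) = alternant t (flag_paths L t) x"
  using assms(2,3)
proof (induction t arbitrary: x)
  case 0
  have "row_shape 0 x = {}" by (auto simp: row_shape_def)
  then show ?case by (simp add: flagged_tableaux_def semistandard_on_def alternant_def)
next
  case (Suc t)
  show ?case
  proof (cases "x t < L (Suc t)")
    case True
    have dec: "x (Suc j) < x j" if "j < t" for j using Suc.prems(1)[of j] that by simp
    have low: "x j \<ge> - int t - 1" if "j \<le> t" for j using Suc.prems(2)[of j] that by simp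
    have fin: "finite (strip_removals L t x)" unfolding strip_removals_def by (intro finite_PiE) auto
    have "card (flagged_tableaux L (Suc t) (row_shape (Suc t) x)) =
        card (SIGMA y : strip_removals L t x. flagged_tableaux L t (row_shape t y))"
      using bij_betw_same_card[OF flagged_tableaux_Suc[of t x L]] Suc.prems True low[of t] by simp
    also have "\<dots> = (\<Sum>y \<in> strip_removals L t x. card (flagged_tableaux L t (row_shape t y)))"
      by (intro card_SigmaI fin ballI finite_flagged_tableaux finite_row_shape)
    finally have "int (card (flagged_tableaux L (Suc t) (row_shape (Suc t) x))) =
        (\<Sum>y \<in> strip_removals L t x. int (card (flagged_tableaux L t (row_shape t y))))" by simp
    also have "\<dots> = (\<Sum>y \<in> strip_removals L t x. alternant t (flag_paths L t) y)"
    proof (rule sum.cong[OF refl])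
      fix y assume y: "y \<in> strip_removals L t x"
      note b = strip_removals_bounds[of t x y L, OF Suc.prems(1) y]
      show "int (card (flagged_tableaux L t (row_shape t y))) = alternant t (flag_paths L t) y"
      proof (rule Suc.IH)
        fix j assume "Suc j < t" then show "y (Suc j) < y j" using b(1)[of j] b(2)[of "Suc j"] by simp
      next
        fix j assume "j < t" then show "y j \<ge> - int t" using b(1)[of j] low[of "Suc j"] by simp
      qed
    qed
    also have "\<dots> = alternant (Suc t) (flag_paths L (Suc t)) x"
      by (rule alternant_flag_paths_Suc[of t x L, symmetric]) (use dec low True in auto)
    finally show ?thesis .
  next
    case False
    have "x j \<ge> x t" if "j \<le> t" for j
      using strict_decreasing_le[of "Suc t" x j t] Suc.prems(1) that by simp
    then have "alternant (Suc t) (flag_paths L (Suc t)) x = 0"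
      using False by (intro alternant_flag_paths_eq_0) force
    moreover have "flagged_tableaux L (Suc t) (row_shape (Suc t) x) = {}"
      using flagged_tableaux_empty[of t x L] Suc.prems False assms(1) by simp
    ultimately show ?thesis by (simp del: flag_paths.simps)
  qed
qed

section \<open>Exchanging the indices of a minor\<close>

text \<open>
  For injective \<open>z\<close>, the sign of the permutation that sorts \<open>z\<close> into decreasing order.  Written as a product over
  pairs, the effect of changing one value can be read off factor by factor.
\<close>

definition order_sign :: "nat \<Rightarrow> (nat \<Rightarrow> int) \<Rightarrow> int" where
  "order_sign d z = (\<Prod>(i, j) \<in> {(i, j). i < j \<and> j < d}. sgn (z i - z j))"

lemma finite_pairs: "finite {(i, j). i < j \<and> j < (d :: nat)}"
  by (rule finite_subset[of _ "{..<d} \<times> {..<d}"]) auto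

lemma order_sign_decreasing:
  assumes "\<And>j. Suc j < d \<Longrightarrow> z (Suc j) < z j"
  shows "order_sign d z = 1"
  unfolding order_sign_def
proof (rule prod.neutral, clarify)
  fix i j :: nat assume "i < j" "j < d"
  then show "sgn (z i - z j) = 1"
    using strict_decreasing_le[of d z i j] assms by simp
qed

lemma order_sign_square:
  assumes "inj_on z {..<d}"
  shows "order_sign d z * order_sign d z = 1"
  unfolding order_sign_def prod.distrib[symmetric]
proof (rule prod.neutral, clarify)
  fix i j :: nat assume "i < j" "j < d"
  then have "z i \<noteq> z j" using inj_onD[OF assms, of i j] by auto
  then show "sgn (z i - z j) * sgn (z i - z j) = 1" by (auto simp: sgn_if)
qed

lemma order_sign_swap:
  assumes "Suc k < d"
  shows "order_sign d (z \<circ> transpose k (Suc k)) = - order_sign d z"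
proof -
  let ?P = "{(i, j). i < j \<and> j < d}"
  let ?Q = "?P - {(k, Suc k)}"
  let ?t = "transpose k (Suc k)"
  let ?g = "\<lambda>(i, j). (?t i, ?t j)"
  have split: "(\<Prod>(i, j) \<in> ?P. sgn (w i - w j)) = sgn (w k - w (Suc k)) * (\<Prod>(i, j) \<in> ?Q. sgn (w i - w j))"
    for w :: "nat \<Rightarrow> int"
    using prod.remove[OF finite_pairs[of d], of "(k, Suc k)" "\<lambda>(i, j). sgn (w i - w j)"] assms by auto
  have g: "?g p \<in> ?Q" if p: "p \<in> ?Q" for p
    using p assms by (auto simp: transpose_def split: if_splits)
  have "(\<Prod>(i, j) \<in> ?Q. sgn ((z \<circ> ?t) i - (z \<circ> ?t) j)) = (\<Prod>(i, j) \<in> ?Q. sgn (z i - z j))"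
    by (rule prod.reindex_bij_witness[where i = ?g and j = ?g]) (use g in \<open>auto split: prod.splits\<close>)
  then show ?thesis
    unfolding order_sign_def split by (simp add: sgn_if)
qed

lemma alternant_swap:
  assumes "Suc k < d"
  shows "alternant d p (z \<circ> transpose k (Suc k)) = - alternant d p z"
proof -
  let ?A = "mat d d (\<lambda>(j, i). p i (z j))"
  let ?t = "transpose k (Suc k)"
  have t: "?t permutes {0..<d}" using assms by (intro permutes_swap_id) auto
  have "det (mat d d (\<lambda>(i, j). ?A $$ (?t i, j))) = signof ?t * det ?A"
    by (rule det_permute_rows[OF _ t]) simp
  moreover have "mat d d (\<lambda>(i, j). ?A $$ (?t i, j)) = mat d d (\<lambda>(j, i). p i ((z \<circ> ?t) j))"
    using permutes_in_image[OF t] by (intro eq_matI) auto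
  ultimately show ?thesis by (simp add: alternant_def sign_swap_id)
qed

text \<open>
  Swapping an adjacent ascent lowers the sum of the \<open>j * (z j - lo)\<close>, a nonnegative integer, so
  finitely many such swaps reach a decreasing sequence.
\<close>

lemma sort_by_adjacent_swaps:
  fixes z :: "nat \<Rightarrow> int"
  assumes inj: "inj_on z {..<d}" and low: "\<And>j. j < d \<Longrightarrow> z j \<ge> lo"
    and sorted: "\<And>z. (\<And>j. j < d \<Longrightarrow> z j \<ge> lo) \<Longrightarrow> (\<And>j. Suc j < d \<Longrightarrow> z (Suc j) < z j) \<Longrightarrow> P z"
    and swap: "\<And>z k. inj_on z {..<d} \<Longrightarrow> Suc k < d \<Longrightarrow> P (z \<circ> transpose k (Suc k)) \<Longrightarrow> P z"
  shows "P z"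
  using inj low
proof (induction "nat (\<Sum>j<d. int j * (z j - lo))" arbitrary: z rule: less_induct)
  case less
  show ?case
  proof (cases "\<forall>j. Suc j < d \<longrightarrow> z (Suc j) < z j")
    case True
    then show ?thesis using sorted less.prems(2) by blast
  next
    case False
    then obtain k where k: "Suc k < d" "z k \<le> z (Suc k)" by force
    have "z k \<noteq> z (Suc k)" using inj_onD[OF less.prems(1), of k "Suc k"] k(1) by auto
    then have lt: "z k < z (Suc k)" using k(2) by simp
    let ?t = "transpose k (Suc k)"
    let ?w = "z \<circ> ?t"
    have t: "?t permutes {..<d}" using k(1) by (intro permutes_swap_id) auto
    have "inj_on ?w {..<d}"
      using less.prems(1) permutes_image[OF t] permutes_inj_on[OF t] by (intro comp_inj_on) auto
    moreover have wlow: "?w j \<ge> lo" if "j < d" for j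
      using less.prems(2)[of "?t j"] permutes_in_image[OF t, of j] that by auto
    moreover have "(\<Sum>j<d. int j * (?w j - lo)) < (\<Sum>j<d. int j * (z j - lo))"
    proof -
      have split: "(\<Sum>j<d. int j * (v j - lo)) = int k * (v k - lo) + (int (Suc k) * (v (Suc k) - lo) +
          (\<Sum>j \<in> {..<d} - {k} - {Suc k}. int j * (v j - lo)))" for v :: "nat \<Rightarrow> int"
        using k(1) by (subst sum.remove[of _ k], simp, simp, subst sum.remove[of _ "Suc k"]) auto
      have "(\<Sum>j \<in> {..<d} - {k} - {Suc k}. int j * (?w j - lo)) =
          (\<Sum>j \<in> {..<d} - {k} - {Suc k}. int j * (z j - lo))"
        by (rule sum.cong) (auto simp: transpose_def)
      then show ?thesis unfolding split using lt by (simp add: algebra_simps)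
    qed
    moreover have "0 \<le> (\<Sum>j<d. int j * (?w j - lo))"
      using wlow by (intro sum_nonneg mult_nonneg_nonneg) auto
    ultimately have "P ?w" by (intro less.hyps) auto
    then show ?thesis using swap[OF less.prems(1) k(1)] by blast
  qed
qed

text \<open>
  Both sides change sign under an adjacent swap, so it is enough to know them on decreasing
  sequences.
\<close>

lemma alternant_eq_order_sign:
  assumes sorted: "\<And>z. (\<And>j. j < d \<Longrightarrow> z j \<ge> lo) \<Longrightarrow> (\<And>j. Suc j < d \<Longrightarrow> z (Suc j) < z j) \<Longrightarrow>
      alternant d p z = F (z ` {..<d})"
    and inj: "inj_on z {..<d}" and low: "\<And>j. j < d \<Longrightarrow> z j \<ge> lo"
  shows "alternant d p z = order_sign d z * F (z ` {..<d})"
  using inj low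
proof (rule sort_by_adjacent_swaps)
  fix z :: "nat \<Rightarrow> int"
  assume "\<And>j. j < d \<Longrightarrow> lo \<le> z j" "\<And>j. Suc j < d \<Longrightarrow> z (Suc j) < z j"
  then show "alternant d p z = order_sign d z * F (z ` {..<d})"
    using sorted[of z] order_sign_decreasing[of d z] by simp
next
  fix z :: "nat \<Rightarrow> int" and k
  assume k: "Suc k < d" and IH: "alternant d p (z \<circ> transpose k (Suc k)) =
    order_sign d (z \<circ> transpose k (Suc k)) * F ((z \<circ> transpose k (Suc k)) ` {..<d})"
  have "transpose k (Suc k) permutes {..<d}" using k by (intro permutes_swap_id) auto
  then have "(z \<circ> transpose k (Suc k)) ` {..<d} = z ` {..<d}"
    by (metis image_comp permutes_image)
  then show "alternant d p z = order_sign d z * F (z ` {..<d})"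
    using IH alternant_swap[OF k] order_sign_swap[OF k] by simp
qed

text \<open>
  Only the pairs that contain the position \<open>q\<close> see the change.
\<close>

lemma order_sign_replace:
  assumes q: "q < d" and inj: "inj_on z {..<d}"
  shows "order_sign d z * order_sign d (z(q := s)) =
    (\<Prod>j \<in> {..<d} - {q}. sgn (z q - z j) * sgn (s - z j))"
proof -
  let ?P = "{(i, j). i < j \<and> j < d}"
  let ?w = "z(q := s)"
  let ?f = "\<lambda>(i, j). sgn (z i - z j) * sgn (?w i - ?w j)"
  let ?Q = "{(i, j). i < j \<and> j < d \<and> (i = q \<or> j = q)}"
  have "order_sign d z * order_sign d ?w = prod ?f ?P"
    unfolding order_sign_def prod.distrib[symmetric] by (rule prod.cong) auto
  also have "\<dots> = prod ?f ?Q"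
  proof (rule prod.mono_neutral_right[OF finite_pairs])
    show "\<forall>p \<in> ?P - ?Q. ?f p = 1"
    proof
      fix p assume p: "p \<in> ?P - ?Q"
      obtain i j where [simp]: "p = (i, j)" by fastforce
      have "i \<noteq> q" "j \<noteq> q" "z i \<noteq> z j" using p inj_onD[OF inj, of i j] by auto
      then show "?f p = 1" by (auto simp: sgn_if)
    qed
  qed auto
  also have "\<dots> = (\<Prod>j \<in> {..<d} - {q}. sgn (z q - z j) * sgn (s - z j))"
    by (rule prod.reindex_bij_witness[where i = "\<lambda>j. if j < q then (j, q) else (q, j)" and
          j = "\<lambda>(i, j). if i = q then j else i"])
      (use q in \<open>auto simp: sgn_if split: if_splits\<close>)
  finally show ?thesis .
qed

lemma prod_ordered_pairs:
  fixes G :: "nat \<Rightarrow> nat \<Rightarrow> 'a :: comm_monoid_mult"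
  shows "(\<Prod>q<d. \<Prod>j \<in> {..<d} - {q}. G q j) = (\<Prod>(i, j) \<in> {(i, j). i < j \<and> j < d}. G i j * G j i)"
proof -
  let ?P = "{(i, j). i < j \<and> j < d}"
  let ?P' = "{(i, j). j < i \<and> i < d}"
  have fin: "finite ?P'" by (rule finite_subset[of _ "{..<d} \<times> {..<d}"]) auto
  have "(\<Prod>q<d. \<Prod>j \<in> {..<d} - {q}. G q j) = (\<Prod>(q, j) \<in> (SIGMA q:{..<d}. {..<d} - {q}). G q j)"
    by (rule prod.Sigma) auto
  also have "(SIGMA q:{..<d}. {..<d} - {q}) = ?P \<union> ?P'" by auto
  also have "(\<Prod>(q, j) \<in> ?P \<union> ?P'. G q j) = (\<Prod>(q, j) \<in> ?P. G q j) * (\<Prod>(q, j) \<in> ?P'. G q j)"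
    by (rule prod.union_disjoint[OF finite_pairs fin]) auto
  also have "(\<Prod>(q, j) \<in> ?P'. G q j) = (\<Prod>(i, j) \<in> ?P. G j i)"
    by (rule prod.reindex_bij_witness[where i = "\<lambda>(i, j). (j, i)" and j = "\<lambda>(i, j). (j, i)"]) auto
  also have "(\<Prod>(q, j) \<in> ?P. G q j) * (\<Prod>(i, j) \<in> ?P. G j i) = (\<Prod>(i, j) \<in> ?P. G i j * G j i)"
    unfolding prod.distrib[symmetric] by (rule prod.cong) auto
  finally show ?thesis .
qed

lemma det_scale_rows_columns:
  fixes f :: "nat \<Rightarrow> nat \<Rightarrow> 'a :: comm_ring_1"
  shows "det (mat n n (\<lambda>(i, j). a i * b j * f i j)) = (\<Prod>i<n. a i * b i) * det (mat n n (\<lambda>(i, j). f i j))"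
proof -
  have eq: "(\<Prod>i = 0..<n. mat n n (\<lambda>(i, j). a i * b j * f i j) $$ (i, p i)) =
      (\<Prod>i<n. a i * b i) * (\<Prod>i = 0..<n. mat n n (\<lambda>(i, j). f i j) $$ (i, p i))"
    if p: "p permutes {0..<n}" for p
  proof -
    have pl: "p i < n" if "i < n" for i using permutes_in_image[OF p, of i] that by auto
    have "(\<Prod>i = 0..<n. mat n n (\<lambda>(i, j). a i * b j * f i j) $$ (i, p i)) =
       (\<Prod>i = 0..<n. a i) * (\<Prod>i = 0..<n. b (p i)) * (\<Prod>i = 0..<n. mat n n (\<lambda>(i, j). f i j) $$ (i, p i))"
      unfolding prod.distrib[symmetric] by (rule prod.cong) (simp_all add: pl)
    also have "(\<Prod>i = 0..<n. b (p i)) = (\<Prod>i = 0..<n. b i)"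
      using prod.permute[OF p, of b] by (simp add: comp_def)
    finally show ?thesis by (simp add: prod.distrib lessThan_atLeast0)
  qed
  have "det (mat n n (\<lambda>(i, j). a i * b j * f i j)) = (\<Sum>p\<in>{p. p permutes {0..<n}}. signof p *
         (\<Prod>i = 0..<n. mat n n (\<lambda>(i, j). a i * b j * f i j) $$ (i, p i)))"
    by (rule det_def') simp
  also have "\<dots> = (\<Sum>p\<in>{p. p permutes {0..<n}}. (\<Prod>i<n. a i * b i) * (signof p *
         (\<Prod>i = 0..<n. mat n n (\<lambda>(i, j). f i j) $$ (i, p i))))"
    by (rule sum.cong[OF refl]) (simp only: eq mem_Collect_eq mult.left_commute)
  also have "\<dots> = (\<Prod>i<n. a i * b i) * (\<Sum>p\<in>{p. p permutes {0..<n}}. signof p *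
         (\<Prod>i = 0..<n. mat n n (\<lambda>(i, j). f i j) $$ (i, p i)))"
    by (rule sum_distrib_left[symmetric])
  also have "(\<Sum>p\<in>{p. p permutes {0..<n}}. signof p *
         (\<Prod>i = 0..<n. mat n n (\<lambda>(i, j). f i j) $$ (i, p i))) = det (mat n n (\<lambda>(i, j). f i j))"
    by (rule det_def'[symmetric]) simp
  finally show ?thesis .
qed

lemma alternant_eq_0:
  assumes "i < d" "j < d" "i \<noteq> j" "z i = z j"
  shows "alternant d p z = 0"
  unfolding alternant_def
  by (rule det_identical_rows[OF _ assms(3,1,2)]) (use assms in \<open>auto intro!: eq_vecI\<close>)

text \<open>
  Since the minor for \<open>X\<close> is a unit, the vectors belonging to \<open>X\<close> form a basis, and Cramer's rule
  gives the coordinates of the vectors belonging to \<open>Y\<close> as minors with one exchanged index.  The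
  positions from \<open>n\<close> on, where \<open>X\<close> and \<open>Y\<close> agree, contribute unit vectors, which leave an
  \<open>n\<close>-by-\<open>n\<close> determinant.
\<close>

lemma alternant_exchange:
  assumes X: "alternant d p X * alternant d p X = 1" and "n \<le> d"
    and eq: "\<And>j. n \<le> j \<Longrightarrow> j < d \<Longrightarrow> Y j = X j"
  shows "alternant d p Y = alternant d p X *
    det (mat n n (\<lambda>(q, r). alternant d p X * alternant d p (X(q := Y r))))"
proof -
  define \<sigma> where "\<sigma> = alternant d p X"
  let ?A = "mat d d (\<lambda>(i, j). p i (X j))"
  let ?V = "mat d d (\<lambda>(i, j). p i (Y j))"
  have A: "?A \<in> carrier_mat d d" and V: "?V \<in> carrier_mat d d" by auto
  have alt: "alternant d p z = det (mat d d (\<lambda>(i, j). p i (z j)))" for z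
  proof -
    have "transpose_mat (mat d d (\<lambda>(i, j). p i (z j))) = mat d d (\<lambda>(j, i). p i (z j))"
      by (intro eq_matI) auto
    then show ?thesis
      using det_transpose[of "mat d d (\<lambda>(i, j). p i (z j))" d] by (simp add: alternant_def)
  qed
  have ss: "\<sigma> * \<sigma> = 1" using X by (simp add: \<sigma>_def)
  \<comment> \<open>\<open>C\<close> is the inverse of \<open>?A\<close> times \<open>?V\<close>, since the determinant \<open>\<sigma>\<close> is its own inverse.\<close>
  define C where "C = \<sigma> \<cdot>\<^sub>m (adj_mat ?A * ?V)"
  have C: "C \<in> carrier_mat d d" using adj_mat(1)[OF A] V by (auto simp: C_def)
  have AC: "?A * C = ?V"
  proof -
    have "?A * C = \<sigma> \<cdot>\<^sub>m (?A * (adj_mat ?A * ?V))"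
      unfolding C_def using A adj_mat(1)[OF A] V by (intro mult_smult_distrib) auto
    also have "?A * (adj_mat ?A * ?V) = (?A * adj_mat ?A) * ?V"
      by (rule assoc_mult_mat[symmetric, OF A adj_mat(1)[OF A] V])
    also have "\<dots> = (\<sigma> \<cdot>\<^sub>m 1\<^sub>m d) * ?V"
      unfolding adj_mat(2)[OF A] alt[of X, folded \<sigma>_def] by simp
    also have "\<dots> = \<sigma> \<cdot>\<^sub>m ?V" using V by (subst mult_smult_assoc_mat[of _ d d _ d]) auto
    also have "\<sigma> \<cdot>\<^sub>m (\<sigma> \<cdot>\<^sub>m ?V) = ?V" using ss by (intro eq_matI) (auto simp: mult.assoc[symmetric])
    finally show ?thesis .
  qed
  have entry: "C $$ (q, r) = \<sigma> * alternant d p (X(q := Y r))" if "q < d" "r < d" for q r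
  proof -
    have "det (replace_col ?A (?A *\<^sub>v col C r) q) = col C r $ q * det ?A"
      using C that by (intro cramer_lemma_mat[OF A]) auto
    moreover have "?A *\<^sub>v col C r = col ?V r"
      unfolding AC[symmetric] using A C that by (intro col_mult2[symmetric]) auto
    moreover have "replace_col ?A (col ?V r) q = mat d d (\<lambda>(i, j). p i ((X(q := Y r)) j))"
      using that by (intro eq_matI) (auto simp: replace_col_def)
    moreover have "col C r $ q = C $$ (q, r)" using C that by auto
    ultimately have "alternant d p (X(q := Y r)) = C $$ (q, r) * \<sigma>"
      by (simp add: alt \<sigma>_def)
    then show ?thesis using ss by (simp add: mult.left_commute)
  qed
  let ?C = "mat n n (\<lambda>(q, r). \<sigma> * alternant d p (X(q := Y r)))"
  have "C = four_block_mat ?C (0\<^sub>m n (d - n)) (mat (d - n) n (\<lambda>(q, r). C $$ (q + n, r))) (1\<^sub>m (d - n))"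
    (is "_ = ?F")
  proof (rule eq_matI)
    fix q r assume "q < dim_row ?F" "r < dim_col ?F"
    then have qr: "q < d" "r < d" using \<open>n \<le> d\<close> by auto
    show "C $$ (q, r) = ?F $$ (q, r)"
    proof (cases "r < n")
      case True
      then show ?thesis using qr \<open>n \<le> d\<close> by (auto simp: entry)
    next
      case False
      then have Y: "Y r = X r" using eq qr by auto
      show ?thesis
      proof (cases "q = r")
        case True
        then show ?thesis using Y ss False qr \<open>n \<le> d\<close> by (auto simp: entry \<sigma>_def[symmetric])
      next
        case F: False
        have "alternant d p (X(q := Y r)) = 0"
          by (rule alternant_eq_0[OF qr F]) (use F Y in auto)
        then show ?thesis using False F qr \<open>n \<le> d\<close> by (auto simp: entry)
      qed
    qed
  qed (use C \<open>n \<le> d\<close> in auto)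
  then have "det C = det ?F" by (rule arg_cong)
  also have "\<dots> = det ?C * det (1\<^sub>m (d - n))"
    by (rule det_four_block_mat_upper_right_zero) auto
  finally have "det C = det ?C" by simp
  moreover have "det ?V = \<sigma> * det C"
    using det_mult[OF A C] by (simp add: AC alt \<sigma>_def)
  ultimately show ?thesis by (simp add: alt[of Y] \<sigma>_def)
qed

text \<open>
  The unsigned form of \<open>alternant_exchange\<close>.  The sign of the minor with \<open>X q\<close> exchanged for
  \<open>Y r\<close> splits into a factor depending on \<open>q\<close> and one depending on \<open>r\<close>: the only factor involving
  both, \<open>sgn (Y r - X q)\<close>, is \<open>-1\<close> whenever the minor is nonzero.  So these signs leave the
  determinant as one global sign.  It must equal the product of the signs of \<open>X\<close> and \<open>Y\<close>, and
  comparing the contributions of each pair \<open>i, j\<close> shows that this holds when the intervals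
  from \<open>Y i\<close> to \<open>X i\<close> are pairwise nested or disjoint; two crossing intervals would contribute a
  wrong sign.
\<close>

theorem noncrossing_exchange:
  fixes X Y :: "nat \<Rightarrow> int" and F :: "int set \<Rightarrow> int"
  assumes alt: "\<And>z. inj_on z {..<d} \<Longrightarrow> (\<And>j. j < d \<Longrightarrow> z j \<ge> lo) \<Longrightarrow>
      alternant d p z = order_sign d z * F (z ` {..<d})"
    and F1: "F (X ` {..<d}) = 1" and nd: "n \<le> d"
    and injX: "inj_on X {..<d}" and injY: "inj_on Y {..<d}"
    and lowX: "\<And>j. j < d \<Longrightarrow> X j \<ge> lo" and lowY: "\<And>j. j < d \<Longrightarrow> Y j \<ge> lo"
    and eq: "\<And>j. n \<le> j \<Longrightarrow> j < d \<Longrightarrow> Y j = X j"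
    and new: "\<And>j. j < n \<Longrightarrow> Y j \<notin> X ` {..<d}" and less: "\<And>j. j < n \<Longrightarrow> Y j < X j"
    and noncrossing: "\<And>i j. i < n \<Longrightarrow> j < n \<Longrightarrow> Y i < X j \<Longrightarrow> X j < X i \<Longrightarrow> Y i < Y j"
    and zero: "\<And>i j. i < n \<Longrightarrow> j < n \<Longrightarrow> X j < Y i \<Longrightarrow> F (insert (Y i) (X ` {..<d} - {X j})) = 0"
  shows "F (Y ` {..<d}) = det (mat n n (\<lambda>(i, j). F (insert (Y i) (X ` {..<d} - {X j}))))"
proof -
  let ?f = "\<lambda>q r. F (insert (Y r) (X ` {..<d} - {X q}))"
  let ?G = "\<lambda>q j. sgn (X q - X j) * sgn (Y q - X j)"
  define a where "a = (\<lambda>q. \<Prod>j \<in> {..<d} - {q}. sgn (X q - X j))"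
  define b where "b = (\<lambda>r. - (\<Prod>j<d. sgn (Y r - X j)))"
  have X: "alternant d p X = order_sign d X" using alt[OF injX lowX] F1 by simp
  have Y: "alternant d p Y = order_sign d Y * F (Y ` {..<d})" using alt[OF injY lowY] .
  have XX: "alternant d p X * alternant d p X = 1" using order_sign_square[OF injX] X by simp
  have entry: "alternant d p X * alternant d p (X(q := Y r)) = a q * b r * ?f q r"
    if qr: "q < n" "r < n" for q r
  proof -
    let ?w = "X(q := Y r)"
    have q: "q < d" using qr nd by simp
    have ne: "Y r \<noteq> X j" if "j < d" for j using new[OF qr(2)] that by auto
    have "inj_on ?w {..<d}"
      using inj_onD[OF injX] ne ne[symmetric] by (intro inj_onI) (auto split: if_splits)
    moreover have "?w j \<ge> lo" if "j < d" for j using that lowX lowY[of r] qr nd by auto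
    ultimately have "alternant d p ?w = order_sign d ?w * F (?w ` {..<d})" by (rule alt)
    also have "?w ` {..<d} = insert (Y r) (X ` {..<d} - {X q})"
      using q inj_onD[OF injX, of _ q] by (auto simp: image_iff)
    finally have "alternant d p X * alternant d p ?w = (order_sign d X * order_sign d ?w) * ?f q r"
      by (simp only: X mult.assoc)
    also have "order_sign d X * order_sign d ?w = a q * (\<Prod>j \<in> {..<d} - {q}. sgn (Y r - X j))"
      unfolding order_sign_replace[OF q injX] prod.distrib a_def ..
    also have "a q * (\<Prod>j \<in> {..<d} - {q}. sgn (Y r - X j)) * ?f q r = a q * b r * ?f q r"
    proof (cases "X q < Y r")
      case True
      then show ?thesis using zero[OF qr(2,1)] by simp
    next
      case False
      then have "sgn (Y r - X q) = -1" using ne[OF q] by (auto simp: sgn_if)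
      moreover have "(\<Prod>j<d. sgn (Y r - X j)) = sgn (Y r - X q) * (\<Prod>j \<in> {..<d} - {q}. sgn (Y r - X j))"
        using q by (intro prod.remove) auto
      ultimately show ?thesis by (simp add: b_def)
    qed
    finally show ?thesis .
  qed
  \<comment> \<open>For \<open>q \<ge> n\<close> the factors of \<open>?G q\<close> are squares of signs, so the product may run over all \<open>q < d\<close>
     and be regrouped by unordered pairs.\<close>
  have ab: "(\<Prod>q<n. a q * b q) = order_sign d X * order_sign d Y"
  proof -
    have "a q * b q = (\<Prod>j \<in> {..<d} - {q}. ?G q j)" if "q < n" for q
    proof -
      have "sgn (Y q - X q) = -1" using less[OF that] by simp
      moreover have "(\<Prod>j<d. sgn (Y q - X j)) = sgn (Y q - X q) * (\<Prod>j \<in> {..<d} - {q}. sgn (Y q - X j))"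
        using that nd by (intro prod.remove) auto
      ultimately show ?thesis by (simp add: a_def b_def prod.distrib)
    qed
    then have "(\<Prod>q<n. a q * b q) = (\<Prod>q<n. \<Prod>j \<in> {..<d} - {q}. ?G q j)" by simp
    also have "\<dots> = (\<Prod>q<d. \<Prod>j \<in> {..<d} - {q}. ?G q j)"
    proof (rule prod.mono_neutral_left)
      show "\<forall>q \<in> {..<d} - {..<n}. (\<Prod>j \<in> {..<d} - {q}. ?G q j) = 1"
      proof (intro ballI prod.neutral)
        fix q j assume q: "q \<in> {..<d} - {..<n}" and j: "j \<in> {..<d} - {q}"
        then have "X q \<noteq> X j" using inj_onD[OF injX, of q j] by auto
        moreover have "Y q = X q" using eq q by auto
        ultimately show "?G q j = 1" by (auto simp: sgn_if)
      qed
    qed (use nd in auto)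
    also have "\<dots> = (\<Prod>(i, j) \<in> {(i, j). i < j \<and> j < d}. ?G i j * ?G j i)"
      by (rule prod_ordered_pairs)
    also have "\<dots> = order_sign d X * order_sign d Y"
      unfolding order_sign_def prod.distrib[symmetric]
    proof (rule prod.cong[OF refl], clarify)
      fix i j assume ij: "i < j" "j < d"
      have "X i \<noteq> X j" "Y i \<noteq> Y j"
        using ij inj_onD[OF injX, of i j] inj_onD[OF injY, of i j] by auto
      moreover have "Y k \<noteq> X l" if "k < d" "l < d" "k \<noteq> l" for k l
        using that new[of k] eq[of k] inj_onD[OF injX, of k l] by (cases "k < n") auto
      then have "Y i \<noteq> X j" "Y j \<noteq> X i" using ij by auto
      moreover have le: "Y k \<le> X k" if "k < d" for k
        using that less[of k] eq[of k] by (cases "k < n") auto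
      then have "Y i \<le> X i" "Y j \<le> X j" using ij by auto
      moreover have nc: "Y k < Y l" if "k < d" "l < d" "Y k < X l" "X l < X k" for k l
        using that noncrossing[of k l] eq[of k] eq[of l] by (cases "k < n"; cases "l < n") auto
      then have "Y i < X j \<Longrightarrow> X j < X i \<Longrightarrow> Y i < Y j" "Y j < X i \<Longrightarrow> X i < X j \<Longrightarrow> Y j < Y i"
        using ij by auto
      ultimately show "?G i j * ?G j i = sgn (X i - X j) * sgn (Y i - Y j)"
        by (simp add: sgn_if split: if_splits) linarith?
    qed
    finally show ?thesis .
  qed
  let ?D = "det (mat n n (\<lambda>(q, r). ?f q r))"
  have "alternant d p Y = alternant d p X *
      det (mat n n (\<lambda>(q, r). alternant d p X * alternant d p (X(q := Y r))))"
    by (rule alternant_exchange[OF XX nd eq])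
  also have "mat n n (\<lambda>(q, r). alternant d p X * alternant d p (X(q := Y r))) =
      mat n n (\<lambda>(q, r). a q * b r * ?f q r)"
    by (intro eq_matI) (auto simp: entry)
  also have "det \<dots> = order_sign d X * order_sign d Y * ?D"
    unfolding det_scale_rows_columns ab ..
  finally have "order_sign d Y * F (Y ` {..<d}) = order_sign d Y * ?D"
    using order_sign_square[OF injX] by (simp add: X Y mult.assoc[symmetric])
  then have "order_sign d Y * (order_sign d Y * F (Y ` {..<d})) = order_sign d Y * (order_sign d Y * ?D)"
    by simp
  then have "F (Y ` {..<d}) = ?D"
    using order_sign_square[OF injY] by (simp add: mult.assoc[symmetric])
  also have "\<dots> = det (transpose_mat (mat n n (\<lambda>(q, r). ?f q r)))"
    by (rule det_transpose[symmetric, of _ n]) auto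
  also have "transpose_mat (mat n n (\<lambda>(q, r). ?f q r)) = mat n n (\<lambda>(i, j). ?f j i)"
    by (intro eq_matI) auto
  finally show ?thesis .
qed

section \<open>Partitions as sets of contents\<close>

definition row_end :: "nat list \<Rightarrow> nat \<Rightarrow> int" where
  "row_end mu j = int (part mu (Suc j)) - int j - 1"

definition tail_card :: "int set \<Rightarrow> int \<Rightarrow> int" where
  "tail_card N c = int (card {x \<in> N. c \<le> x})"

text \<open>
  The shape whose row ends, read as contents, form the set \<open>N\<close>: a cell in row \<open>i\<close> belongs to it
  when at least \<open>i\<close> rows reach its content.  This describes the shape without sorting \<open>N\<close>, diagonal
  by diagonal, which is how border strips are seen best.
\<close>

definition maya_shape :: "int set \<Rightarrow> cell set" where
  "maya_shape N = {(i, j). 1 \<le> i \<and> 1 \<le> j \<and> i \<le> tail_card N (j - i)}"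

definition maya_set :: "nat \<Rightarrow> int set \<Rightarrow> bool" where
  "maya_set d N \<longleftrightarrow> finite N \<and> card N = d \<and> N \<subseteq> {- int d..}"

lemma part_antimono:
  assumes "is_partition mu" "1 \<le> i" "i \<le> j"
  shows "part mu j \<le> part mu i"
proof (cases "i < j \<and> j \<le> length mu")
  case True
  then have "mu ! (i - 1) \<ge> mu ! (j - 1)"
    using sorted_wrt_nth_less[of "(\<ge>)" mu "i - 1" "j - 1"] assms by (auto simp: is_partition_def)
  then show ?thesis using True assms by (auto simp: part_def)
next
  case False
  then show ?thesis using assms by (cases "i = j") (auto simp: part_def)
qed

lemma part_pos_iff:
  assumes "is_partition mu" "1 \<le> i"
  shows "0 < part mu i \<longleftrightarrow> i \<le> length mu"
proof
  assume "i \<le> length mu"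
  then have "mu ! (i - 1) \<in> set mu" using assms(2) by auto
  then show "0 < part mu i" using assms \<open>i \<le> length mu\<close> unfolding is_partition_def part_def
    by (metis gr0I)
qed (auto simp: part_def split: if_splits)

lemma row_end_decreasing: "is_partition mu \<Longrightarrow> row_end mu (Suc j) < row_end mu j"
  using part_antimono[of mu "Suc j" "Suc (Suc j)"] by (simp add: row_end_def)

lemma diagram_eq_row_shape:
  assumes "length mu \<le> d"
  shows "diagram mu = row_shape d (row_end mu)"
proof -
  have "(i, j) \<in> diagram mu \<longleftrightarrow> (i, j) \<in> row_shape d (row_end mu)" for i j
  proof (cases "1 \<le> i")
    case True
    then have s: "Suc (nat (i - 1)) = nat i" by simp
    have "i \<le> int d" if "1 \<le> j" "j \<le> int (part mu (nat i))"
      using that assms by (auto simp: part_def split: if_splits)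
    then show ?thesis using True by (auto simp: diagram_def row_shape_def row_end_def s)
  qed (auto simp: diagram_def row_shape_def)
  then show ?thesis by auto
qed

text \<open>
  A decreasing sequence has its values above \<open>c\<close> at an initial segment of the indices, so
  comparing with the \<open>i\<close>-th value amounts to counting.
\<close>

lemma row_shape_eq_maya_shape:
  assumes dec: "\<And>j. Suc j < d \<Longrightarrow> z (Suc j) < z j"
  shows "row_shape d z = maya_shape (z ` {..<d})"
proof -
  have lt: "z j < z i" if "i < j" "j < d" for i j
    using strict_decreasing_le[of d z i j] dec that by simp
  have inj: "inj_on z {..<d}"
    using lt by (intro inj_onI) (metis lessThan_iff less_irrefl linorder_neqE_nat)
  have key: "int k + 1 \<le> tail_card (z ` {..<d}) c \<longleftrightarrow> k < d \<and> c \<le> z k" for k c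
  proof -
    let ?S = "{k. k < d \<and> c \<le> z k}"
    have "{x \<in> z ` {..<d}. c \<le> x} = z ` ?S" by auto
    moreover have "card (z ` ?S) = card ?S" by (rule card_image) (rule inj_on_subset[OF inj], auto)
    ultimately have tc: "tail_card (z ` {..<d}) c = int (card ?S)" by (simp add: tail_card_def)
    have "{..k} \<subseteq> ?S" if "k \<in> ?S"
    proof
      fix i assume "i \<in> {..k}"
      then show "i \<in> ?S" using that lt[of i k] by (cases "i = k") auto
    qed
    moreover have "?S \<subseteq> {..<k}" if "k \<notin> ?S"
    proof
      fix i assume i: "i \<in> ?S"
      show "i \<in> {..<k}"
      proof (rule ccontr)
        assume "i \<notin> {..<k}"
        then have "k \<in> ?S" using i lt[of k i] by (cases "i = k") auto
        then show False using that by simp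
      qed
    qed
    ultimately have "k \<in> ?S \<longleftrightarrow> k < card ?S"
      using card_mono[of ?S "{..k}"] card_mono[of "{..<k}" ?S] by (cases "k \<in> ?S") auto
    then show ?thesis unfolding tc by auto
  qed
  have "(i, j) \<in> row_shape d z \<longleftrightarrow> (i, j) \<in> maya_shape (z ` {..<d})" for i j
  proof (cases "1 \<le> i")
    case True
    then show ?thesis using key[of "nat (i - 1)" "j - i"]
      by (auto simp: row_shape_def maya_shape_def)
  qed (auto simp: row_shape_def maya_shape_def)
  then show ?thesis by auto
qed

lemma maya_set_row_end:
  assumes "is_partition mu" "length mu \<le> d"
  shows "maya_set d (row_end mu ` {..<d})" "diagram mu = maya_shape (row_end mu ` {..<d})"
proof -
  have "inj (row_end mu)"
  proof (rule injI)
    have "row_end mu j < row_end mu i" if "i < j" for i j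
      using strict_decreasing_le[of "Suc j" "row_end mu" i j] row_end_decreasing[OF assms(1)] that by simp
    then show "i = j" if "row_end mu i = row_end mu j" for i j
      using that by (metis less_irrefl linorder_neqE_nat)
  qed
  then have "card (row_end mu ` {..<d}) = d" by (simp add: card_image inj_on_subset)
  then show "maya_set d (row_end mu ` {..<d})" by (auto simp: maya_set_def row_end_def)
  show "diagram mu = maya_shape (row_end mu ` {..<d})"
    unfolding diagram_eq_row_shape[OF assms(2)]
    using row_end_decreasing[OF assms(1)] by (intro row_shape_eq_maya_shape)
qed

lemma maya_set_enumeration:
  assumes "maya_set d N"
  shows "\<exists>z. (\<forall>j. Suc j < d \<longrightarrow> z (Suc j) < z j) \<and> z ` {..<d} = N"
proof -
  let ?xs = "rev (sorted_list_of_set N)"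
  have len: "length ?xs = d" and set: "set ?xs = N"
    using assms by (auto simp: maya_set_def)
  have sorted: "sorted_wrt (>) ?xs"
    by (simp add: sorted_wrt_rev)
  have "?xs ! Suc j < ?xs ! j" if "Suc j < d" for j
    using sorted_wrt_nth_less[OF sorted, of j "Suc j"] that len by simp
  moreover have "(\<lambda>j. ?xs ! j) ` {..<d} = N"
    using set len by (metis lessThan_atLeast0 nth_image take_all_iff le_refl)
  ultimately show ?thesis by blast
qed

lemma partition_of_row_shape:
  assumes dec: "\<And>j. Suc j < d \<Longrightarrow> z (Suc j) < z j"
  shows "\<exists>nu. is_partition nu \<and> diagram nu = row_shape d z"
proof -
  define f where "f = (\<lambda>j. if j < d then nat (z j + int j + 1) else 0)"
  \<comment> \<open>The list of parts must stop before the first empty row.\<close>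
  define r where "r = (LEAST r. f r = 0)"
  have "f d = 0" by (simp add: f_def)
  then have fr: "f r = 0" unfolding r_def by (rule LeastI)
  have pos: "f j \<noteq> 0" if "j < r" for j
    using not_less_Least[of j "\<lambda>r. f r = 0"] that by (auto simp: r_def)
  have anti: "f j \<le> f i" if "i \<le> j" for i j
    using strict_decreasing_le[of d z i j] dec that by (auto simp: f_def)
  let ?nu = "map f [0..<r]"
  have "0 \<notin> set ?nu"
    unfolding set_map set_upt image_iff using pos by (metis atLeastLessThan_iff)
  moreover have "sorted_wrt (\<ge>) ?nu"
    using anti by (simp add: sorted_wrt_iff_nth_less)
  ultimately have "is_partition ?nu" by (simp add: is_partition_def)
  moreover have "part ?nu (Suc j) = f j" for j
    using anti[of r j] fr by (cases "j < r") (auto simp: part_def)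
  then have part: "part ?nu (nat i) = f (nat (i - 1))" if "1 \<le> i" for i
    using that by (metis Suc_nat_eq_nat_zadd1 diff_add_cancel diff_ge_0_iff_ge add.commute)
  have "diagram ?nu = row_shape d z"
  proof -
    have "(i, j) \<in> diagram ?nu \<longleftrightarrow> (i, j) \<in> row_shape d z" for i j
    proof (cases "1 \<le> i")
      case True
      then show ?thesis
        unfolding diagram_def row_shape_def mem_Collect_eq prod.case part[OF True] by (auto simp: f_def)
    qed (auto simp: diagram_def row_shape_def)
    then show ?thesis by auto
  qed
  ultimately show ?thesis by blast
qed

lemma diagram_inject:
  assumes mu: "is_partition mu" and nu: "is_partition nu" and eq: "diagram mu = diagram nu"
  shows "mu = nu"
proof -
  have le: "part rho i \<le> part sigma i" if "diagram rho \<subseteq> diagram sigma" "1 \<le> i" for rho sigma i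
  proof (cases "part rho i = 0")
    case False
    then have "(int i, int (part rho i)) \<in> diagram rho" using that(2) by (auto simp: diagram_def)
    then have "(int i, int (part rho i)) \<in> diagram sigma" using that(1) by blast
    then show ?thesis by (simp add: diagram_def)
  qed simp
  have part: "part mu i = part nu i" if "1 \<le> i" for i
    using le[of mu nu i] le[of nu mu i] that eq by (simp add: le_antisym)
  have "i \<le> length mu \<longleftrightarrow> i \<le> length nu" if "1 \<le> i" for i
    using part_pos_iff[OF mu that] part_pos_iff[OF nu that] part[OF that] by simp
  then have len: "length mu = length nu"
    by (metis One_nat_def Suc_leI le_antisym le_refl length_greater_0_conv list.size(3) not_gr_zero zero_le)
  show ?thesis
  proof (rule nth_equalityI[OF len])
    fix i assume "i < length mu"
    then show "mu ! i = nu ! i" using part[of "Suc i"] len by (simp add: part_def)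
  qed
qed

lemma tail_card_step:
  assumes "finite N"
  shows "tail_card N c = tail_card N (c + 1) + (if c \<in> N then 1 else 0)"
proof -
  have "{x \<in> N. c \<le> x} = {x \<in> N. c + 1 \<le> x} \<union> {x \<in> N. x = c}" by auto
  moreover have "card ({x \<in> N. c + 1 \<le> x} \<union> {x \<in> N. x = c}) =
      card {x \<in> N. c + 1 \<le> x} + card {x \<in> N. x = c}"
    using assms by (intro card_Un_disjoint) auto
  moreover have "{x \<in> N. x = c} = (if c \<in> N then {c} else {})" by auto
  ultimately show ?thesis by (simp add: tail_card_def)
qed

text \<open>
  A set of \<open>d\<close> contents that are all at least \<open>- d\<close> has few elements below \<open>c\<close>, hence many above.
  The lower bound says that diagonals of negative content enter a shape at its left edge: a row
  index from there to \<open>d\<close> gives a positive column index.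
\<close>

lemma tail_card_bounds:
  assumes "maya_set d N"
  shows "tail_card N c \<le> int d" "min (int d) (- c) \<le> tail_card N c" "0 \<le> tail_card N c"
proof -
  have N: "finite N" "card N = d" "N \<subseteq> {- int d..}" using assms by (auto simp: maya_set_def)
  show "tail_card N c \<le> int d"
    unfolding tail_card_def N(2)[symmetric] using N(1) by (auto intro: card_mono)
  have "card N \<le> card ({x \<in> N. c \<le> x} \<union> {- int d..<c})"
    using N by (intro card_mono) auto
  also have "\<dots> \<le> card {x \<in> N. c \<le> x} + card {- int d..<c}" by (rule card_Un_le)
  finally show "min (int d) (- c) \<le> tail_card N c" using N(2) by (auto simp: tail_card_def)
  show "0 \<le> tail_card N c" by (simp add: tail_card_def)
qed

text \<open>
  The conditions \<open>1 \<le> i\<close> and \<open>1 \<le> j\<close> disappear: a row index above \<open>tail_card B (j - i)\<close> is past the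
  edges of the quadrant.
\<close>

lemma maya_shape_diff_iff:
  assumes "maya_set d A" "maya_set d B"
  shows "(i, j) \<in> maya_shape A - maya_shape B \<longleftrightarrow> tail_card B (j - i) < i \<and> i \<le> tail_card A (j - i)"
  using tail_card_bounds[OF assms(1), of "j - i"] tail_card_bounds[OF assms(2), of "j - i"]
  by (auto simp: maya_shape_def)

lemma tail_card_mono_if_subset:
  assumes A: "maya_set d A" and B: "maya_set d B" and sub: "maya_shape B \<subseteq> maya_shape A"
  shows "tail_card B c \<le> tail_card A c"
proof (rule ccontr)
  assume "\<not> ?thesis"
  then have "(tail_card B c, tail_card B c + c) \<in> maya_shape B - maya_shape A"
    by (subst maya_shape_diff_iff[OF B A]) auto
  then show False using sub by blast
qed

section \<open>Tableaux for a fixed outer partition\<close>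

definition content_cap :: "nat list \<Rightarrow> nat \<Rightarrow> int" where
  "content_cap lam s = int (part lam (length lam + 1 - s))"

lemma OOT_eq_card: "OOT lam mu = card (flagged_tableaux (content_cap lam) (length lam) (diagram mu))"
  by (simp add: OOT_def OO_tableaux_def flagged_tableaux_def content_cap_def)

definition OOT_maya :: "nat list \<Rightarrow> int set \<Rightarrow> int" where
  "OOT_maya lam N = int (card (flagged_tableaux (content_cap lam) (length lam) (maya_shape N)))"

text \<open>
  In a column, the entry in row 1 is at most \<open>length lam + 1 - i\<close> when the column has a cell in row
  \<open>i\<close>; its content bound is then at most the \<open>i\<close>-th part of \<open>lam\<close>, so that cell lies in \<open>lam\<close>.
\<close>

lemma flagged_tableau_fits:
  assumes lam: "is_partition lam" and dec: "\<And>j. Suc j < length lam \<Longrightarrow> z (Suc j) < z j"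
    and T: "T \<in> flagged_tableaux (content_cap lam) (length lam) (row_shape (length lam) z)"
  shows "row_shape (length lam) z \<subseteq> diagram lam"
proof
  fix u assume u: "u \<in> row_shape (length lam) z"
  let ?D = "row_shape (length lam) z" and ?d = "length lam"
  obtain i j where [simp]: "u = (i, j)" by fastforce
  have ij: "1 \<le> i" "1 \<le> j" "(i, j) \<in> ?D" using u by (auto simp: row_shape_def)
  have col: "(i', j) \<in> ?D" if "1 \<le> i'" "i' \<le> i" for i'
    using row_shape_column_closed[of ?d z, OF dec ij(3)] that by auto
  have "int (T (1, j)) + (i - 1) \<le> int (T (i, j))"
    using T col ij(1) by (intro semistandard_column_growth[of ?D]) (auto simp: flagged_tableaux_def)
  moreover have "T (i, j) \<le> ?d" "T (1, j) \<le> ?d" "1 \<le> T (1, j)"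
    using T ij col[of 1] by (auto simp: flagged_tableaux_def)
  ultimately have "nat i \<le> ?d + 1 - T (1, j)" by linarith
  moreover have "j - 1 < int (part lam (?d + 1 - T (1, j)))"
    using T ij col[of 1] by (auto simp: flagged_tableaux_def content_def content_cap_def)
  moreover have "part lam (?d + 1 - T (1, j)) \<le> part lam (nat i)"
    using calculation(1) ij by (intro part_antimono[OF lam]) auto
  ultimately have "j \<le> int (part lam (nat i))" by linarith
  then show "u \<in> diagram lam" using ij by (simp add: diagram_def)
qed

text \<open>
  For \<open>mu = lam\<close> the two bounds meet.  A column of length \<open>l\<close> has last entry at most the number
  \<open>d\<close> of parts, while the content bound in row 1 makes the first entry at least \<open>d + 1 - l\<close>; so the
  column must be \<open>d + 1 - l, ..., d\<close>, and these columns do form a tableau.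
\<close>

lemma OOT_self:
  assumes lam: "is_partition lam"
  shows "OOT lam lam = 1"
proof -
  let ?d = "length lam" and ?D = "diagram lam"
  define cl where "cl = (\<lambda>j. card {r \<in> {1..?d}. j \<le> int (part lam r)})"
  have cl_le: "cl j \<le> ?d" for j
    unfolding cl_def by (rule order_trans[OF card_mono[of "{1..?d}"]]) auto
  have cl: "r \<le> cl j \<longleftrightarrow> j \<le> int (part lam r)" if r: "1 \<le> r" "r \<le> ?d" for r j
  proof
    assume "j \<le> int (part lam r)"
    then have "{1..r} \<subseteq> {r \<in> {1..?d}. j \<le> int (part lam r)}"
      using part_antimono[OF lam, of _ r] r by fastforce
    then show "r \<le> cl j" unfolding cl_def using card_mono[of _ "{1..r}"] by fastforce
  next
    assume le: "r \<le> cl j"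
    show "j \<le> int (part lam r)"
    proof (rule ccontr)
      assume neg: "\<not> ?thesis"
      have "{r \<in> {1..?d}. j \<le> int (part lam r)} \<subseteq> {1..<r}"
      proof
        fix x assume x: "x \<in> {r \<in> {1..?d}. j \<le> int (part lam r)}"
        have "\<not> r \<le> x"
          using neg part_antimono[OF lam r(1), of x] x by auto
        then show "x \<in> {1..<r}" using x by simp
      qed
      then have "cl j \<le> card {1..<r}" unfolding cl_def by (intro card_mono) auto
      then show False using le r by simp
    qed
  qed
  have mem: "(i, j) \<in> ?D \<longleftrightarrow> 1 \<le> i \<and> 1 \<le> j \<and> i \<le> int (cl j)" for i j
  proof (cases "1 \<le> i \<and> 1 \<le> j")
    case True
    show ?thesis
    proof (cases "nat i \<le> ?d")
      case True
      moreover have "1 \<le> nat i" using \<open>1 \<le> i \<and> 1 \<le> j\<close> by linarith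
      ultimately have "nat i \<le> cl j \<longleftrightarrow> j \<le> int (part lam (nat i))" by (intro cl)
      then show ?thesis using \<open>1 \<le> i \<and> 1 \<le> j\<close> by (auto simp: diagram_def nat_le_iff)
    next
      case False
      then show ?thesis using \<open>1 \<le> i \<and> 1 \<le> j\<close> cl_le[of j] by (auto simp: diagram_def part_def)
    qed
  qed (auto simp: diagram_def)
  define T0 :: "cell \<Rightarrow> nat" where
    "T0 = (\<lambda>u\<in>?D. nat (int ?d - int (cl (snd u)) + fst u))"
  have "flagged_tableaux (content_cap lam) ?d ?D = {T0}"
  proof (intro equalityI subsetI)
    fix T assume T: "T \<in> flagged_tableaux (content_cap lam) ?d ?D"
    have "T = T0"
    proof (rule extensionalityI)
      show "T \<in> extensional ?D" using T by (auto simp: flagged_tableaux_def PiE_def)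
      show "T0 \<in> extensional ?D" by (simp add: T0_def)
      fix u assume u: "u \<in> ?D"
      obtain i j where [simp]: "u = (i, j)" by fastforce
      have ij: "1 \<le> i" "1 \<le> j" "i \<le> int (cl j)" using u mem by auto
      have TD: "T (i', j) \<in> {1..?d}" if "1 \<le> i'" "i' \<le> int (cl j)" for i'
        using T mem[of i' j] that ij by (auto simp: flagged_tableaux_def)
      have grow: "int (T (a, j)) + (b - a) \<le> int (T (b, j))" if "1 \<le> a" "a \<le> b" "b \<le> int (cl j)" for a b
        using T that ij mem by (intro semistandard_column_growth[of ?D]) (auto simp: flagged_tableaux_def)
      have "content (1, j) < content_cap lam (T (1, j))"
        using T mem[of 1 j] ij by (auto simp: flagged_tableaux_def)
      then have "j \<le> int (part lam (?d + 1 - T (1, j)))" by (simp add: content_def content_cap_def)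
      then have "?d + 1 - T (1, j) \<le> cl j" using cl[of "?d + 1 - T (1, j)" j] TD[of 1] ij by auto
      moreover have "int (T (1, j)) + (i - 1) \<le> int (T (i, j))" using grow[of 1 i] ij by auto
      moreover have "int (T (i, j)) + (int (cl j) - i) \<le> int (T (int (cl j), j))"
        using grow[of i "int (cl j)"] ij by auto
      moreover have "T (int (cl j), j) \<le> ?d" using TD[of "int (cl j)"] ij by auto
      ultimately show "T u = T0 u" using u by (auto simp: T0_def)
    qed
    then show "T \<in> {T0}" by simp
  next
    fix T assume "T \<in> {T0}"
    then have [simp]: "T = T0" by simp
    have T0: "int (T0 (i, j)) = int ?d - int (cl j) + i" if "(i, j) \<in> ?D" for i j
      using that cl_le[of j] mem[of i j] by (simp add: T0_def)
    have mono: "cl (j + 1) \<le> cl j" for j unfolding cl_def by (intro card_mono) auto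
    have "T0 u \<in> {1..?d} \<and> content u < content_cap lam (T0 u)" if u: "u \<in> ?D" for u
    proof -
      obtain i j where [simp]: "u = (i, j)" by fastforce
      have ij: "1 \<le> i" "1 \<le> j" "i \<le> int (cl j)" using u mem by auto
      have T0u: "int (T0 u) = int ?d - int (cl j) + i" using T0 u by simp
      then have r: "?d + 1 - T0 u = cl j - nat i + 1" using ij cl_le[of j] by linarith
      have "1 \<le> nat i" "nat i \<le> cl j" using ij by linarith+
      then have r': "1 \<le> cl j - nat i + 1" "cl j - nat i + 1 \<le> ?d" "cl j - nat i + 1 \<le> cl j"
        using cl_le[of j] by linarith+
      have "j \<le> int (part lam (cl j - nat i + 1))" using cl[OF r'(1,2), of j] r'(3) by blast
      then have "content u < content_cap lam (T0 u)"
        using ij unfolding content_cap_def r by (simp add: content_def)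
      moreover have "T0 u \<in> {1..?d}" using T0u ij cl_le[of j] by auto
      ultimately show ?thesis by simp
    qed
    moreover have "semistandard_on ?D T0"
      unfolding semistandard_on_def
    proof (intro conjI allI impI; elim conjE)
      fix i j assume "(i, j) \<in> ?D" "(i, j + 1) \<in> ?D"
      then show "T0 (i, j) \<le> T0 (i, j + 1)" using T0[of i j] T0[of i "j + 1"] mono[of j] by linarith
    next
      fix i j assume "(i, j) \<in> ?D" "(i + 1, j) \<in> ?D"
      then show "T0 (i, j) < T0 (i + 1, j)" using T0[of i j] T0[of "i + 1" j] by linarith
    qed
    ultimately show "T \<in> flagged_tableaux (content_cap lam) ?d ?D"
      by (auto simp: flagged_tableaux_def T0_def PiE_iff)
  qed
  then show ?thesis by (simp add: OOT_eq_card)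
qed

lemma alternant_eq_OOT_maya:
  assumes "inj_on z {..<length lam}" and "\<And>j. j < length lam \<Longrightarrow> z j \<ge> - int (length lam)"
  shows "alternant (length lam) (flag_paths (content_cap lam) (length lam)) z =
    order_sign (length lam) z * OOT_maya lam (z ` {..<length lam})"
proof (rule alternant_eq_order_sign[OF _ assms])
  fix z :: "nat \<Rightarrow> int"
  assume z: "\<And>j. j < length lam \<Longrightarrow> - int (length lam) \<le> z j"
    "\<And>j. Suc j < length lam \<Longrightarrow> z (Suc j) < z j"
  have shape: "row_shape (length lam) z = maya_shape (z ` {..<length lam})"
    by (rule row_shape_eq_maya_shape) (rule z(2))
  show "alternant (length lam) (flag_paths (content_cap lam) (length lam)) z = OOT_maya lam (z ` {..<length lam})"
    unfolding OOT_maya_def shape[symmetric]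
    by (rule card_flagged_tableaux[symmetric]) (use z in \<open>auto simp: content_cap_def\<close>)
qed

lemma length_le_if_diagram_subset:
  assumes "is_partition mu" "diagram mu \<subseteq> diagram lam"
  shows "length mu \<le> length lam"
proof (cases "mu = []")
  case False
  then have len: "1 \<le> length mu" by (cases mu) auto
  then have "0 < part mu (length mu)" using part_pos_iff[OF assms(1) len] by simp
  then have "(int (length mu), 1) \<in> diagram mu" using len by (auto simp: diagram_def)
  then have "(int (length mu), 1) \<in> diagram lam" using assms(2) by blast
  then show ?thesis by (auto simp: diagram_def part_def split: if_splits)
qed simp

lemma OOT_eq_OOT_maya:
  assumes "is_partition mu" "diagram mu \<subseteq> diagram lam"
  shows "int (OOT lam mu) = OOT_maya lam (row_end mu ` {..<length lam})"
  using maya_set_row_end(2)[OF assms(1) length_le_if_diagram_subset[OF assms]]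
  by (simp add: OOT_eq_card OOT_maya_def)

lemma maya_set_exchange:
  assumes "maya_set d A" "b \<in> A" "s \<notin> A" "- int d \<le> s"
  shows "maya_set d (insert s (A - {b}))"
  using assms card_Suc_Diff1[of A b] by (auto simp: maya_set_def)

text \<open>
  Exchanging a row end \<open>b\<close> for a smaller content \<open>s\<close> shortens by one every diagonal with content
  in \<open>s + 1, ..., b\<close>, and so removes a border strip.
\<close>

lemma tail_card_exchange:
  assumes "finite A" "b \<in> A" "s \<notin> A"
  shows "tail_card (insert s (A - {b})) c = tail_card A c - (if c \<le> b then 1 else 0) + (if c \<le> s then 1 else 0)"
proof -
  have b: "card {x \<in> A. c \<le> x} = card {x \<in> A - {b}. c \<le> x} + (if c \<le> b then 1 else 0)"
  proof (cases "c \<le> b")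
    case True
    then have "{x \<in> A. c \<le> x} = insert b {x \<in> A - {b}. c \<le> x}" using assms(2) by auto
    then show ?thesis using True assms(1) by simp
  next
    case False
    then have "{x \<in> A. c \<le> x} = {x \<in> A - {b}. c \<le> x}" by auto
    then show ?thesis using False by simp
  qed
  have s: "card {x \<in> insert s (A - {b}). c \<le> x} = card {x \<in> A - {b}. c \<le> x} + (if c \<le> s then 1 else 0)"
  proof (cases "c \<le> s")
    case True
    then have "{x \<in> insert s (A - {b}). c \<le> x} = insert s {x \<in> A - {b}. c \<le> x}" by auto
    then show ?thesis using True assms(1,3) by simp
  next
    case False
    then have "{x \<in> insert s (A - {b}). c \<le> x} = {x \<in> A - {b}. c \<le> x}" by auto
    then show ?thesis using False by simp
  qed
  show ?thesis unfolding tail_card_def using b s by simp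
qed

lemma OOT_maya_eq_0:
  assumes lam: "is_partition lam" and N: "maya_set (length lam) N"
    and fits: "\<not> maya_shape N \<subseteq> diagram lam"
  shows "OOT_maya lam N = 0"
proof -
  obtain z where dec: "\<And>j. Suc j < length lam \<Longrightarrow> z (Suc j) < z j" and z: "z ` {..<length lam} = N"
    using maya_set_enumeration[OF N] by blast
  have shape: "row_shape (length lam) z = maya_shape N"
    using row_shape_eq_maya_shape[of "length lam" z] dec z by simp
  have "flagged_tableaux (content_cap lam) (length lam) (maya_shape N) = {}"
    using flagged_tableau_fits[of lam z, OF lam dec] fits unfolding shape by blast
  then show ?thesis by (simp add: OOT_maya_def)
qed

lemma partition_of_maya_set:
  assumes "maya_set d N"
  obtains nu where "is_partition nu" "diagram nu = maya_shape N"
proof -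
  obtain z where dec: "\<And>j. Suc j < d \<Longrightarrow> z (Suc j) < z j" and z: "z ` {..<d} = N"
    using maya_set_enumeration[OF assms] by blast
  show ?thesis
    using that partition_of_row_shape[of d z, OF dec] row_shape_eq_maya_shape[of d z, OF dec] z by auto
qed

lemma inner_partition_eq:
  assumes nu: "is_partition nu" "diagram nu \<subseteq> diagram lam" and S: "skew_diagram lam nu = S"
  shows "inner_partition lam S = nu"
  unfolding inner_partition_def
proof (rule the_equality)
  fix rho assume rho: "is_partition rho \<and> diagram rho \<subseteq> diagram lam \<and> skew_diagram lam rho = S"
  then have "diagram rho = diagram nu" using nu S unfolding skew_diagram_def by blast
  then show "rho = nu" using rho nu diagram_inject by blast
qed (use assms in auto)

section \<open>Nested intervals of a height profile\<close>

text \<open>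
  The function \<open>g\<close> will be the number of cells of \<open>lam/mu\<close> on a diagonal, and \<open>A\<close>, \<open>B\<close> the row
  ends of \<open>lam\<close> and \<open>mu\<close>.  Read from left to right, \<open>g\<close> is a height profile that goes up just
  after the elements of \<open>B - A\<close> and down just after those of \<open>A - B\<close>.
\<close>

locale lattice_profile =
  fixes A B :: "int set" and g :: "int \<Rightarrow> int"
  assumes step: "g c = g (c + 1) + (if c \<in> A then 1 else 0) - (if c \<in> B then 1 else 0)"
    and nonneg: "0 \<le> g c" and finite_support: "finite {c. 0 < g c}"
begin

text \<open>
  The interval from \<open>a\<close> to \<open>b\<close> is a connected component of the set where the profile exceeds
  \<open>k\<close>.  As in the matching of parentheses, arcs pair the up-steps with the down-steps.
\<close>

definition arc :: "int \<Rightarrow> int \<Rightarrow> int \<Rightarrow> bool" where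
  "arc k a b \<longleftrightarrow> 0 \<le> k \<and> a \<le> b \<and> (\<forall>c\<in>{a..b}. k < g c) \<and> g (a - 1) \<le> k \<and> g (b + 1) \<le> k"

lemma arc_right: "arc k a b \<Longrightarrow> b \<in> A - B \<and> g (b + 1) = k"
  using step[of b] unfolding arc_def by (force split: if_splits)

lemma arc_left: "arc k a b \<Longrightarrow> a - 1 \<in> B - A \<and> g (a - 1) = k"
  using step[of "a - 1"] unfolding arc_def by (force split: if_splits)

lemma arc_unique_left:
  assumes "arc k a b" "arc k' a' b"
  shows "k = k' \<and> a = a'"
proof -
  have k: "k = k'" using arc_right[OF assms(1)] arc_right[OF assms(2)] by simp
  have "\<not> a' < a" if "arc k a b" "arc k a' b" for a a'
  proof
    assume "a' < a"
    then have "a - 1 \<in> {a'..b}" using that by (auto simp: arc_def)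
    then show False using that unfolding arc_def by fastforce
  qed
  then show ?thesis using assms k by (meson linorder_neqE)
qed

lemma superlevel_component:
  assumes "0 \<le> k" "k < g c"
  shows "\<exists>a b. arc k a b \<and> a \<le> c \<and> c \<le> b"
proof -
  have fin: "finite {c. k < g c}"
    by (rule finite_subset[OF _ finite_support]) (use assms in auto)
  let ?R = "{b. c \<le> b \<and> (\<forall>x\<in>{c..b}. k < g x)}" and ?L = "{a. a \<le> c \<and> (\<forall>x\<in>{a..c}. k < g x)}"
  have R: "finite ?R" "c \<in> ?R" and L: "finite ?L" "c \<in> ?L"
    using assms by (auto intro: finite_subset[OF _ fin])
  define b where "b = Max ?R"
  define a where "a = Min ?L"
  have b: "b \<in> ?R" unfolding b_def using R by (intro Max_in) auto
  have a: "a \<in> ?L" unfolding a_def using L by (intro Min_in) auto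
  have "b + 1 \<notin> ?R" using Max_ge[OF R(1), of "b + 1"] by (auto simp: b_def[symmetric])
  moreover have "{c..b + 1} = insert (b + 1) {c..b}" using b by auto
  ultimately have b1: "g (b + 1) \<le> k" using b by (auto simp: not_less)
  have "a - 1 \<notin> ?L" using Min_le[OF L(1), of "a - 1"] by (auto simp: a_def[symmetric])
  moreover have "{a - 1..c} = insert (a - 1) {a..c}" using a by auto
  ultimately have a1: "g (a - 1) \<le> k" using a by (auto simp: not_less)
  have "k < g x" if "x \<in> {a..b}" for x
    using a b that by (cases "x \<le> c") auto
  then show ?thesis using a b a1 b1 assms(1) unfolding arc_def by (intro exI[of _ a] exI[of _ b]) auto
qed

lemma arc_right_exists:
  assumes "b \<in> A - B"
  shows "\<exists>k a. arc k a b"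
proof -
  have "g (b + 1) < g b" using step[of b] assms by simp
  then obtain a b' where arc: "arc (g (b + 1)) a b'" "a \<le> b" "b \<le> b'"
    using superlevel_component[OF nonneg] by blast
  have "\<not> b < b'"
  proof
    assume "b < b'"
    then have "b + 1 \<in> {a..b'}" using arc by auto
    then show False using arc(1) unfolding arc_def by blast
  qed
  then show ?thesis using arc by (metis order_le_less)
qed

lemma arc_left_exists:
  assumes "s \<in> B - A"
  shows "\<exists>k b. arc k (s + 1) b"
proof -
  have "g s < g (s + 1)" using step[of s] assms by simp
  then obtain a b where arc: "arc (g s) a b" "a \<le> s + 1" "s + 1 \<le> b"
    using superlevel_component[OF nonneg] by blast
  have "\<not> a < s + 1"
  proof
    assume "a < s + 1"
    then have "s \<in> {a..b}" using arc by auto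
    then show False using arc(1) unfolding arc_def by blast
  qed
  then show ?thesis using arc by (metis order_le_less)
qed

text \<open>
  Components of superlevel sets are nested or disjoint.  Ending inside an arc of level \<open>k\<close> forces
  a higher level, and the left neighbour of \<open>a\<close> has height \<open>k\<close>, so it cannot belong to the
  inner arc.
\<close>

lemma arcs_noncrossing:
  assumes "arc k a b" "arc k' a' b'" "a - 1 < b'" "b' < b"
  shows "a < a'"
proof (rule ccontr)
  assume "\<not> a < a'"
  have "b' + 1 \<in> {a..b}" using assms by auto
  then have "k < k'" using assms(1) arc_right[OF assms(2)] unfolding arc_def by fastforce
  moreover have "g (a - 1) = k" using arc_left[OF assms(1)] by simp
  moreover have "a - 1 = a' - 1 \<or> a - 1 \<in> {a'..b'}" using \<open>\<not> a < a'\<close> assms(3) by auto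
  moreover have "g (a' - 1) = k'" using arc_left[OF assms(2)] by simp
  ultimately show False using assms(2) unfolding arc_def by fastforce
qed

end

text \<open>
  If the cells are adjacent exactly when their contents are consecutive, a walk cannot skip a
  content, so connectedness is connectedness of the set of contents.
\<close>

lemma connected_components_of_path:
  fixes f :: "int \<Rightarrow> cell"
  assumes cont: "\<And>c. content (f c) = c"
    and adj: "\<And>c c'. adjacent (f c) (f c') \<longleftrightarrow> \<bar>c - c'\<bar> = 1"
  shows "connected_components (f ` G) =
    {f ` {c'. {min c c'..max c c'} \<subseteq> G} |c. c \<in> G}"
proof -
  let ?E = "{(u, v). u \<in> f ` G \<and> v \<in> f ` G \<and> adjacent u v}"
  have inj: "f c = f c' \<longleftrightarrow> c = c'" for c c' using cont by metis
  have to: "\<exists>c'. v = f c' \<and> {min c c'..max c c'} \<subseteq> G" if "(f c, v) \<in> ?E\<^sup>*" "c \<in> G" for c v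
    using that(1)
  proof (induction rule: rtrancl_induct)
    case base
    show ?case using that(2) by (intro exI[of _ c]) auto
  next
    case (step v w)
    then obtain c' where c': "v = f c'" "{min c c'..max c c'} \<subseteq> G" by auto
    obtain c'' where c'': "w = f c''" "c'' \<in> G" using step.hyps(2) by auto
    have "\<bar>c' - c''\<bar> = 1" using step.hyps(2) adj c' c'' by auto
    then have "{min c c''..max c c''} \<subseteq> {min c c'..max c c'} \<union> {c''}" by auto
    then show ?case using c' c'' by (intro exI[of _ c'']) auto
  qed
  have up: "(f c, f c') \<in> ?E\<^sup>*" if "c \<le> c'" "{c..c'} \<subseteq> G" for c c'
    using that
  proof (induction c' rule: int_ge_induct)
    case (step i)
    then have "(f c, f i) \<in> ?E\<^sup>*" by (auto simp: subset_eq)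
    moreover have "(f i, f (i + 1)) \<in> ?E" using step adj[of i "i + 1"] by (auto simp: subset_eq)
    ultimately show ?case by (rule rtrancl_into_rtrancl)
  qed simp
  have "sym ?E" by (auto simp: sym_def adjacent_def abs_minus_commute)
  then have symE: "(v, u) \<in> ?E\<^sup>*" if "(u, v) \<in> ?E\<^sup>*" for u v
    using sym_rtrancl[of ?E] that by (auto dest: symD)
  have class_eq: "(?E\<^sup>* \<inter> f ` G \<times> f ` G) `` {f c} = f ` {c'. {min c c'..max c c'} \<subseteq> G}"
    if c: "c \<in> G" for c
  proof (intro equalityI subsetI)
    fix v assume "v \<in> (?E\<^sup>* \<inter> f ` G \<times> f ` G) `` {f c}"
    then show "v \<in> f ` {c'. {min c c'..max c c'} \<subseteq> G}" using to[of c v] c by auto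
  next
    fix v assume "v \<in> f ` {c'. {min c c'..max c c'} \<subseteq> G}"
    then obtain c' where c': "v = f c'" "{min c c'..max c c'} \<subseteq> G" by auto
    have "(f c, f c') \<in> ?E\<^sup>*"
    proof (cases "c \<le> c'")
      case True
      then show ?thesis using up[of c c'] c' by simp
    next
      case False
      then show ?thesis using symE[OF up[of c' c]] c' by simp
    qed
    moreover have "c' \<in> G" using c' by auto
    ultimately show "v \<in> (?E\<^sup>* \<inter> f ` G \<times> f ` G) `` {f c}" using c c' by auto
  qed
  show ?thesis
    unfolding connected_components_def quotient_def using class_eq by auto
qed

section \<open>Strips of the Lascoux--Pragacz decomposition\<close>

text \<open>
  In this locale \<open>A\<close> and \<open>B\<close> are the row ends of \<open>lam\<close> and \<open>mu\<close>, with \<open>mu\<close> padded by empty rows to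
  the number of parts of \<open>lam\<close>.
\<close>

locale skew_shape =
  fixes lam mu :: "nat list"
  assumes lam: "is_partition lam" and mu: "is_partition mu" and sub: "diagram mu \<subseteq> diagram lam"
begin

definition A where "A = row_end lam ` {..<length lam}"
definition B where "B = row_end mu ` {..<length lam}"
definition profile where "profile c = tail_card A c - tail_card B c"

lemma maya: "maya_set (length lam) A" "maya_set (length lam) B"
  and diagrams: "diagram lam = maya_shape A" "diagram mu = maya_shape B"
  unfolding A_def B_def
  using maya_set_row_end[OF lam] maya_set_row_end[OF mu] length_le_if_diagram_subset[OF mu sub] by auto

lemma skew_iff:
  "(i, j) \<in> skew_diagram lam mu \<longleftrightarrow> tail_card B (j - i) < i \<and> i \<le> tail_card A (j - i)"
  unfolding skew_diagram_def diagrams by (rule maya_shape_diff_iff[OF maya])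

lemma finite_skew: "finite (skew_diagram lam mu)"
  unfolding skew_diagram_def diagram_eq_row_shape[OF order_refl] by (simp add: finite_row_shape)

lemma content_skew: "content ` skew_diagram lam mu = {c. 0 < profile c}"
proof (intro equalityI subsetI)
  fix c assume "c \<in> {c. 0 < profile c}"
  then have "(tail_card A c, tail_card A c + c) \<in> skew_diagram lam mu"
    by (simp add: skew_iff profile_def)
  then show "c \<in> content ` skew_diagram lam mu" by (force simp: content_def)
qed (auto simp: skew_iff profile_def content_def)

sublocale lattice_profile A B profile
proof
  show "profile c = profile (c + 1) + (if c \<in> A then 1 else 0) - (if c \<in> B then 1 else 0)" for c
    using maya tail_card_step[of A c] tail_card_step[of B c] by (simp add: profile_def maya_set_def)
  show "0 \<le> profile c" for c
    using tail_card_mono_if_subset[OF maya, of c] sub unfolding diagrams by (simp add: profile_def)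
  show "finite {c. 0 < profile c}"
    using finite_skew by (simp flip: content_skew)
qed

text \<open>
  The cell of content \<open>c\<close> in the border strip of \<open>lam\<close>, moved \<open>k\<close> steps to the northwest.
\<close>

definition layer_cell :: "int \<Rightarrow> int \<Rightarrow> cell" where
  "layer_cell k c = (tail_card A c - k, tail_card A c - k + c)"

lemma content_layer_cell [simp]: "content (layer_cell k c) = c"
  by (simp add: content_def layer_cell_def)

lemma adjacent_layer_cell: "adjacent (layer_cell k c) (layer_cell k c') \<longleftrightarrow> \<bar>c - c'\<bar> = 1"
proof
  assume "\<bar>c - c'\<bar> = 1"
  then have "c' = c + 1 \<or> c = c' + 1" by auto
  moreover have "finite A" using maya by (simp add: maya_set_def)
  ultimately show "adjacent (layer_cell k c) (layer_cell k c')"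
    using tail_card_step[of A c] tail_card_step[of A c']
    by (auto simp: adjacent_def layer_cell_def)
next
  assume "adjacent (layer_cell k c) (layer_cell k c')"
  then show "\<bar>c - c'\<bar> = 1" by (simp add: adjacent_def layer_cell_def) arith
qed

lemma border_strip_iff:
  "(i, j) \<in> border_strip lam \<longleftrightarrow> (i, j) \<in> maya_shape A \<and> i = tail_card A (j - i)"
  unfolding border_strip_def diagrams by (auto simp: maya_shape_def)

lemma content_bounds:
  assumes "0 < profile c"
  shows "min_content (skew_diagram lam mu) \<le> c" "c \<le> max_content (skew_diagram lam mu)"
proof -
  have "c \<in> content ` skew_diagram lam mu" using assms by (simp add: content_skew)
  then show "min_content (skew_diagram lam mu) \<le> c" "c \<le> max_content (skew_diagram lam mu)"
    using finite_skew by (auto simp: min_content_def max_content_def)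
qed

text \<open>
  On the diagonal of content \<open>c\<close>, the skew shape consists of the last \<open>profile c\<close> cells of \<open>lam\<close>.
  Hence the border strip moved \<open>k\<close> steps to the northwest meets it exactly where the profile exceeds
  \<open>k\<close>, while translates in the other direction leave \<open>lam\<close>.
\<close>

lemma layer:
  "skew_diagram lam mu \<inter> translate k (LP_cutting_strip lam mu) =
    (if k \<le> 0 then layer_cell (- k) ` {c. - k < profile c} else {})"
proof -
  have translate: "(i, j) \<in> translate k S \<longleftrightarrow> (i - k, j - k) \<in> S" for i j S
    by (force simp: translate_def)
  have "(i, j) \<in> skew_diagram lam mu \<inter> translate k (LP_cutting_strip lam mu) \<longleftrightarrow>
      k \<le> 0 \<and> - k < profile (j - i) \<and> i = tail_card A (j - i) + k" for i j
  proof
    assume "k \<le> 0 \<and> - k < profile (j - i) \<and> i = tail_card A (j - i) + k"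
    then have k: "k \<le> 0" "- k < profile (j - i)" "i = tail_card A (j - i) + k" by auto
    have "(tail_card A (j - i), tail_card A (j - i) + (j - i)) \<in> skew_diagram lam mu"
      using k by (simp add: skew_iff profile_def)
    then have "(tail_card A (j - i), tail_card A (j - i) + (j - i)) \<in> maya_shape A"
      by (simp add: skew_diagram_def diagrams)
    moreover have "(i - k, j - k) = (tail_card A (j - i), tail_card A (j - i) + (j - i))"
      using k(3) by simp
    ultimately have "(i - k, j - k) \<in> maya_shape A" by (simp only:)
    moreover have "(i, j) \<in> skew_diagram lam mu" using k by (simp add: skew_iff profile_def)
    ultimately show "(i, j) \<in> skew_diagram lam mu \<inter> translate k (LP_cutting_strip lam mu)"
      using k content_bounds[of "j - i"]
      by (auto simp: translate LP_cutting_strip_def substrip_def border_strip_iff content_def)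
  qed (auto simp: translate LP_cutting_strip_def substrip_def border_strip_iff skew_iff profile_def)
  then have *: "u \<in> skew_diagram lam mu \<inter> translate k (LP_cutting_strip lam mu) \<longleftrightarrow>
      k \<le> 0 \<and> - k < profile (content u) \<and> u = layer_cell (- k) (content u)" for u
    by (cases u) (auto simp: content_def layer_cell_def)
  show ?thesis
  proof (rule Set.set_eqI)
    fix u
    show "u \<in> skew_diagram lam mu \<inter> translate k (LP_cutting_strip lam mu) \<longleftrightarrow>
      u \<in> (if k \<le> 0 then layer_cell (- k) ` {c. - k < profile c} else {})"
      unfolding * by auto
  qed
qed

text \<open>
  The translate by \<open>k\<close> steps contributes the connected components of the set where the profile
  exceeds \<open>k\<close>, and these are the arcs of level \<open>k\<close>.
\<close>

lemma LP_decomposition_arcs: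
  "LP_decomposition lam mu = {layer_cell k ` {a..b} |k a b. arc k a b}"
proof -
  have comp: "connected_components (layer_cell k ` {c. k < profile c}) =
      {layer_cell k ` {a..b} |a b. arc k a b}" if k: "0 \<le> k" for k
  proof -
    let ?G = "{c. k < profile c}"
    have interval: "{c'. {min c c'..max c c'} \<subseteq> ?G} = {a..b}" if "arc k a b" "a \<le> c" "c \<le> b" for a b c
    proof (intro equalityI subsetI)
      fix c' assume c': "c' \<in> {c'. {min c c'..max c c'} \<subseteq> ?G}"
      have "\<not> c' < a"
      proof
        assume "c' < a"
        then have "a - 1 \<in> {min c c'..max c c'}" using that by auto
        then have "a - 1 \<in> ?G" using c' by blast
        then show False using that(1) by (auto simp: arc_def)
      qed
      moreover have "\<not> b < c'"
      proof
        assume "b < c'"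
        then have "b + 1 \<in> {min c c'..max c c'}" using that by auto
        then have "b + 1 \<in> ?G" using c' by blast
        then show False using that(1) by (auto simp: arc_def)
      qed
      ultimately show "c' \<in> {a..b}" by auto
    next
      fix c' assume "c' \<in> {a..b}"
      then have "{min c c'..max c c'} \<subseteq> {a..b}" using that by auto
      also have "\<dots> \<subseteq> ?G" using that(1) by (auto simp: arc_def)
      finally show "c' \<in> {c'. {min c c'..max c c'} \<subseteq> ?G}" by simp
    qed
    have "connected_components (layer_cell k ` ?G) =
        {layer_cell k ` {c'. {min c c'..max c c'} \<subseteq> ?G} |c. c \<in> ?G}"
      by (rule connected_components_of_path) (simp_all add: adjacent_layer_cell)
    also have "\<dots> = {layer_cell k ` {a..b} |a b. arc k a b}"
    proof (intro equalityI subsetI)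
      fix C assume "C \<in> {layer_cell k ` {c'. {min c c'..max c c'} \<subseteq> ?G} |c. c \<in> ?G}"
      then obtain c where c: "k < profile c" "C = layer_cell k ` {c'. {min c c'..max c c'} \<subseteq> ?G}" by auto
      obtain a b where "arc k a b" "a \<le> c" "c \<le> b" using superlevel_component[OF k c(1)] by blast
      then show "C \<in> {layer_cell k ` {a..b} |a b. arc k a b}" using interval c(2) by auto
    next
      fix C assume "C \<in> {layer_cell k ` {a..b} |a b. arc k a b}"
      then obtain a b where ab: "arc k a b" "C = layer_cell k ` {a..b}" by auto
      moreover have "a \<le> b" "a \<in> ?G" using ab(1) by (auto simp: arc_def)
      ultimately show "C \<in> {layer_cell k ` {c'. {min c c'..max c c'} \<subseteq> ?G} |c. c \<in> ?G}"
        using interval[of a b a] by (intro CollectI exI[of _ a]) simp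
    qed
    finally show ?thesis .
  qed
  have "connected_components {} = {}" by (simp add: connected_components_def)
  then have cc: "connected_components (skew_diagram lam mu \<inter> translate k (LP_cutting_strip lam mu)) =
      (if k \<le> 0 then {layer_cell (- k) ` {a..b} |a b. arc (- k) a b} else {})" for k
    unfolding layer using comp[of "- k"] by auto
  show ?thesis
  proof (intro equalityI subsetI)
    fix C assume "C \<in> LP_decomposition lam mu"
    then show "C \<in> {layer_cell k ` {a..b} |k a b. arc k a b}"
      unfolding LP_decomposition_def outside_decomposition_def cc by (auto split: if_splits)
  next
    fix C assume "C \<in> {layer_cell k ` {a..b} |k a b. arc k a b}"
    then obtain k a b where C: "C = layer_cell k ` {a..b}" "arc k a b" by auto
    then have "0 \<le> k" by (simp add: arc_def)
    then show "C \<in> LP_decomposition lam mu"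
      unfolding LP_decomposition_def outside_decomposition_def cc
      using C by (intro UN_I[of "- k"]) auto
  qed
qed

lemma content_bounds_arc:
  assumes "a \<le> b"
  shows "min_content (layer_cell k ` {a..b}) = a" "max_content (layer_cell k ` {a..b}) = b"
proof -
  have "content ` layer_cell k ` {a..b} = {a..b}" by (simp add: image_image)
  then show "min_content (layer_cell k ` {a..b}) = a" "max_content (layer_cell k ` {a..b}) = b"
    using assms by (auto simp: min_content_def max_content_def intro: Min_eqI Max_eqI)
qed

text \<open>
  Joining the start of one strip to the end of another amounts to exchanging one row end of \<open>lam\<close>.
  If the end does not lie to the left of the start, this removes the joined piece of the border
  strip; otherwise it adds cells outside \<open>lam\<close>, and no tableau is left.  An empty join never occurs:
  \<open>b' = a - 1\<close> would lie both in \<open>A - B\<close> and in \<open>B - A\<close>.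
\<close>

lemma OOT_join_arcs:
  assumes arc: "arc k a b" and arc': "arc k' a' b'"
  shows "int (OOT_join lam (LP_cutting_strip lam mu) (layer_cell k ` {a..b}) (layer_cell k' ` {a'..b'})) =
    OOT_maya lam (insert (a - 1) (A - {b'}))"
    and "b' < a - 1 \<Longrightarrow> OOT_maya lam (insert (a - 1) (A - {b'})) = 0"
proof -
  let ?N = "insert (a - 1) (A - {b'})"
  have le: "a \<le> b" "a' \<le> b'" using arc arc' by (auto simp: arc_def)
  have b': "b' \<in> A" "b' \<notin> B" using arc_right[OF arc'] by auto
  have a: "a - 1 \<in> B" "a - 1 \<notin> A" using arc_left[OF arc] by auto
  have fin: "finite A" using maya by (simp add: maya_set_def)
  have "- int (length lam) \<le> a - 1" using a(1) maya(2) by (auto simp: maya_set_def)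
  then have N: "maya_set (length lam) ?N" by (intro maya_set_exchange maya b' a)
  note tc = tail_card_exchange[OF fin b'(1) a(2)]
  show zero: "OOT_maya lam ?N = 0" if "b' < a - 1"
  proof (rule OOT_maya_eq_0[OF lam N])
    let ?i = "tail_card A (a - 1) + 1"
    have "(?i, ?i + (a - 1)) \<in> maya_shape ?N - maya_shape A"
      using that by (subst maya_shape_diff_iff[OF N maya(1)]) (simp add: tc)
    then show "\<not> maya_shape ?N \<subseteq> diagram lam" unfolding diagrams by blast
  qed
  show "int (OOT_join lam (LP_cutting_strip lam mu) (layer_cell k ` {a..b}) (layer_cell k' ` {a'..b'})) =
    OOT_maya lam ?N"
  proof (cases "b' < a - 1")
    case True
    then show ?thesis using zero by (simp add: OOT_join_def content_bounds_arc le)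
  next
    case False
    moreover have "b' \<noteq> a - 1" using a b' by auto
    ultimately have ab: "a \<le> b'" by simp
    obtain nu where nu: "is_partition nu" "diagram nu = maya_shape ?N"
      by (rule partition_of_maya_set[OF N])
    have nsub: "diagram nu \<subseteq> diagram lam"
      unfolding nu(2) diagrams using ab by (auto simp: maya_shape_def tc split: if_splits)
    have "0 < profile a" "0 < profile b'"
      using arc arc' unfolding arc_def by force+
    then have cb: "min_content (skew_diagram lam mu) \<le> a" "b' \<le> max_content (skew_diagram lam mu)"
      using content_bounds by auto
    have "skew_diagram lam nu = substrip (LP_cutting_strip lam mu) a b'"
    proof -
      have "(i, j) \<in> skew_diagram lam nu \<longleftrightarrow> (i, j) \<in> substrip (LP_cutting_strip lam mu) a b'" for i j
      proof -
        have "(i, j) \<in> skew_diagram lam nu \<longleftrightarrow>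
            tail_card ?N (j - i) < i \<and> i \<le> tail_card A (j - i)"
          unfolding skew_diagram_def diagrams nu(2) by (rule maya_shape_diff_iff[OF maya(1) N])
        also have "\<dots> \<longleftrightarrow> a \<le> j - i \<and> j - i \<le> b' \<and> i = tail_card A (j - i)"
          using ab by (auto simp: tc)
        finally have iff: "(i, j) \<in> skew_diagram lam nu \<longleftrightarrow> a \<le> j - i \<and> j - i \<le> b' \<and> i = tail_card A (j - i)" .
        moreover have "(i, j) \<in> maya_shape A" if "(i, j) \<in> skew_diagram lam nu"
          using that by (simp add: skew_diagram_def diagrams)
        ultimately show ?thesis
          using cb by (auto simp: LP_cutting_strip_def substrip_def border_strip_iff content_def)
      qed
      then show ?thesis by auto
    qed
    then have "inner_partition lam (substrip (LP_cutting_strip lam mu) a b') = nu"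
      by (rule inner_partition_eq[OF nu(1) nsub])
    then have "OOT_join lam (LP_cutting_strip lam mu) (layer_cell k ` {a..b}) (layer_cell k' ` {a'..b'}) = OOT lam nu"
      using ab by (simp add: OOT_join_def strip_join_def content_bounds_arc le)
    then show ?thesis by (simp add: OOT_eq_card OOT_maya_def nu(2))
  qed
qed

text \<open>
  The ends of the strips enumerate \<open>A - B\<close>, and their starts, moved one step to the left, enumerate
  \<open>B - A\<close>.  Completing both enumerations by the common elements in the same order gives sequences
  \<open>X\<close> and \<open>Y\<close> for \<open>noncrossing_exchange\<close>; the strips are noncrossing because they are
  arcs.
\<close>

theorem OOT_eq_det_LP:
  assumes dist: "distinct thetas" and set: "set thetas = LP_decomposition lam mu"
  shows "int (OOT lam mu) =
    det (mat (length thetas) (length thetas)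
      (\<lambda>(i, j). int (OOT_join lam (LP_cutting_strip lam mu) (thetas ! i) (thetas ! j))))"
proof -
  let ?n = "length thetas" and ?d = "length lam"
  have "\<exists>k a b. arc k a b \<and> thetas ! i = layer_cell k ` {a..b}" if "i < ?n" for i
    using nth_mem[OF that] unfolding set LP_decomposition_arcs by auto
  then obtain k a b where arcs: "\<And>i. i < ?n \<Longrightarrow> arc (k i) (a i) (b i)"
    and theta: "\<And>i. i < ?n \<Longrightarrow> thetas ! i = layer_cell (k i) ` {a i..b i}" by metis
  have all_arcs: "\<exists>i<?n. k i = k' \<and> a i = a' \<and> b i = b'" if "arc k' a' b'" for k' a' b'
  proof -
    have "layer_cell k' ` {a'..b'} \<in> set thetas" unfolding set LP_decomposition_arcs using that by auto
    then obtain i where i: "i < ?n" "thetas ! i = layer_cell k' ` {a'..b'}" by (metis in_set_conv_nth)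
    have le: "a i \<le> b i" "a' \<le> b'" using arcs[OF i(1)] that by (auto simp: arc_def)
    have "a i = a'" "b i = b'"
      using content_bounds_arc[OF le(1), of "k i"] content_bounds_arc[OF le(2), of k'] theta[OF i(1)] i(2) by auto
    then show ?thesis using arc_unique_left arcs[OF i(1)] that i(1) by metis
  qed
  have injb: "inj_on b {..<?n}"
  proof (rule inj_onI)
    fix i j assume ij: "i \<in> {..<?n}" "j \<in> {..<?n}" "b i = b j"
    then have "arc (k i) (a i) (b j)" "arc (k j) (a j) (b j)" using arcs[of i] arcs[of j] by auto
    then have "k i = k j \<and> a i = a j" by (rule arc_unique_left)
    then have "thetas ! i = thetas ! j" using ij theta[of i] theta[of j] by simp
    then show "i = j" using dist ij by (simp add: nth_eq_iff_index_eq)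
  qed
  have imb: "b ` {..<?n} = A - B"
  proof (intro equalityI subsetI)
    fix x assume "x \<in> A - B"
    then obtain k' a' where "arc k' a' x" using arc_right_exists by blast
    then show "x \<in> b ` {..<?n}" using all_arcs by blast
  qed (use arcs arc_right in blast)
  have ima: "(\<lambda>i. a i - 1) ` {..<?n} = B - A"
  proof (intro equalityI subsetI)
    fix x assume "x \<in> B - A"
    then obtain k' b' where "arc k' (x + 1) b'" using arc_left_exists by blast
    then obtain i where "i < ?n" "a i = x + 1" using all_arcs by blast
    then show "x \<in> (\<lambda>i. a i - 1) ` {..<?n}" by (intro image_eqI[of _ _ i]) auto
  qed (use arcs arc_left in blast)
  have finA: "finite A" "card A = ?d" and finB: "finite B" "card B = ?d"
    using maya by (auto simp: maya_set_def)
  have "card A = card (A - B) + card (A \<inter> B)"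
    using finA(1) by (metis card_Diff_subset_Int card_mono finite_Int inf_le1 le_add_diff_inverse2)
  also have "card (A - B) = ?n" using card_image[OF injb] imb by simp
  finally have d: "?d = ?n + card (A \<inter> B)" using finA by simp
  obtain h where h: "bij_betw h {0..<card (A \<inter> B)} (A \<inter> B)"
    using ex_bij_betw_nat_finite[of "A \<inter> B"] finA by auto
  define X where "X = (\<lambda>j. if j < ?n then b j else h (j - ?n))"
  define Y where "Y = (\<lambda>j. if j < ?n then a j - 1 else h (j - ?n))"
  have split: "{..<?d} = {..<?n} \<union> (\<lambda>j. j + ?n) ` {0..<card (A \<inter> B)}"
  proof -
    have "x \<in> (\<lambda>j. j + ?n) ` {0..<card (A \<inter> B)}" if "?n \<le> x" "x < ?d" for x
      using that d by (intro image_eqI[of _ _ "x - ?n"]) auto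
    then show ?thesis using d by force
  qed
  have imX: "X ` {..<?d} = A" and imY: "Y ` {..<?d} = B"
  proof -
    have "X ` {..<?d} = b ` {..<?n} \<union> h ` {0..<card (A \<inter> B)}"
      unfolding split image_Un image_image X_def by auto
    then show "X ` {..<?d} = A" using imb bij_betw_imp_surj_on[OF h] by auto
    have "Y ` {..<?d} = (\<lambda>i. a i - 1) ` {..<?n} \<union> h ` {0..<card (A \<inter> B)}"
      unfolding split image_Un image_image Y_def by auto
    then show "Y ` {..<?d} = B" using ima bij_betw_imp_surj_on[OF h] by auto
  qed
  have "OOT_maya lam (Y ` {..<?d}) =
      det (mat ?n ?n (\<lambda>(i, j). OOT_maya lam (insert (Y i) (X ` {..<?d} - {X j}))))"
  proof (rule noncrossing_exchange)
    show "alternant ?d (flag_paths (content_cap lam) ?d) z = order_sign ?d z * OOT_maya lam (z ` {..<?d})"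
      if "inj_on z {..<?d}" "\<And>j. j < ?d \<Longrightarrow> - int ?d \<le> z j" for z
      using that by (rule alternant_eq_OOT_maya)
    show "OOT_maya lam (X ` {..<?d}) = 1"
      using OOT_eq_OOT_maya[OF lam order_refl] OOT_self[OF lam] by (simp add: imX A_def)
    show "?n \<le> ?d" using d by simp
    show "inj_on X {..<?d}" by (rule eq_card_imp_inj_on) (simp_all add: imX finA)
    show "inj_on Y {..<?d}" by (rule eq_card_imp_inj_on) (simp_all add: imY finB)
    show "- int ?d \<le> X j" if "j < ?d" for j
      using that maya(1) imX by (auto simp: maya_set_def)
    show "- int ?d \<le> Y j" if "j < ?d" for j
      using that maya(2) imY by (auto simp: maya_set_def)
    show "Y j = X j" if "?n \<le> j" for j using that by (simp add: X_def Y_def)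
    show "Y j \<notin> X ` {..<?d}" if "j < ?n" for j
      using that ima unfolding imX by (auto simp: Y_def)
    show "Y j < X j" if "j < ?n" for j
      using arcs[OF that] that by (auto simp: X_def Y_def arc_def)
    show "Y i < Y j" if "i < ?n" "j < ?n" "Y i < X j" "X j < X i" for i j
      using arcs_noncrossing[OF arcs[OF that(1)] arcs[OF that(2)]] that by (simp add: X_def Y_def)
    show "OOT_maya lam (insert (Y i) (X ` {..<?d} - {X j})) = 0"
      if "i < ?n" "j < ?n" "X j < Y i" for i j
      using OOT_join_arcs(2)[OF arcs[OF that(1)] arcs[OF that(2)]] that unfolding imX
      by (simp add: X_def Y_def)
  qed
  moreover have "mat ?n ?n (\<lambda>(i, j). OOT_maya lam (insert (Y i) (X ` {..<?d} - {X j}))) =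
      mat ?n ?n (\<lambda>(i, j). int (OOT_join lam (LP_cutting_strip lam mu) (thetas ! i) (thetas ! j)))"
    unfolding imX by (intro eq_matI) (simp_all add: theta OOT_join_arcs(1)[OF arcs arcs] X_def Y_def)
  ultimately show ?thesis
    using OOT_eq_OOT_maya[OF mu sub] by (simp add: imY B_def)
qed

end

theorem theorem6p11:
  fixes lam mu :: "nat list" and thetas :: "cell set list"
  assumes "is_partition lam" and "is_partition mu"
    and "diagram mu \<subseteq> diagram lam"
    and "distinct thetas" and "set thetas = LP_decomposition lam mu"
  shows "int (OOT lam mu) =
    det (mat (length thetas) (length thetas)
      (\<lambda>(i, j). int (OOT_join lam (LP_cutting_strip lam mu) (thetas ! i) (thetas ! j))))"
proof -
  interpret skew_shape lam mu using assms(1-3) by unfold_locales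
  show ?thesis by (rule OOT_eq_det_LP[OF assms(4,5)])
qed

end
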